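(* Define $\mathcal H:\mathcal P(\mathcal X)\times\mathbb R^n\to\mathbb R$ by $$\mathcal H(p,\Phi)=\tfrac12\sum_{(i,j)\in E}H_{ij}\big((\overline\nabla_\omega\Phi)_{i,j}\big)\theta_{ij}(p)+\mathcal F(p).$$ The potential mean field game system $$\frac{dp_s(i)}{ds}+\sum_{j\in\mathcal N_i}\sqrt{\omega_{ij}}\,\theta_{ij}(p_s)H'_{ij}\big((\overline\nabla_\omega\Phi_s)_{i,j}\big)=0,\qquad \frac{d\Phi_s(i)}{ds}+\sum_{j\in\mathcal N_i}H_{ij}\big((\overline\nabla_\omega\Phi_s)_{i,j}\big)\frac{\partial\theta_{ij}}{\partial p_i}(p_s)+\frac{\partial}{\partial p_i}\mathcal F(p_s)=0,\quad t\le s\le T,$$ $p_t(i)=p_i$, $\Phi_T(i)=\frac{\partial}{\partial p_T(i)}\mathcal G(p_T)$, is a Hamiltonian system in $\mathcal P(\mathcal X)$, namely $$\frac{d}{ds}p_s(i)=\frac{\partial}{\partial\Phi_i}\mathcal H(p_s,\Phi_s),\qquad \frac{d}{ds}\Phi_s(i)=-\frac{\partial}{\partial p_i}\mathcal H(p_s,\Phi_s),\quad t\le s\le T,\qquad p_t(i)=p_i,\quad \Phi_T(i)=\frac{\partial}{\partial p_T(i)}\mathcal G(p_T).$$ Assume there exists a classical solution $\mathcal U(p,t)$ to the Hamilton–Jacobi equation in $\mathcal P(\mathcal X)$ $$\frac{\partial}{\partial t}\mathcal U(p,t)+\mathcal H(p,\nabla_p\mathcal U(p,t))=0,\quad t\le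 T,\qquad \mathcal U(p,T)=\mathcal G(p).$$ Then the value function $$\sup_{v_s,p_s}\Big\{\mathcal G(p_T)-\int_t^T\Big(\tfrac12\sum_{(i,j)\in E}\theta_{ij}(p_s)L_{ij}(v_s(ij))-\mathcal F(p_s)\Big)ds\Big\}$$ subject to $\frac{dp_s(i)}{ds}+\sum_{j\in\mathcal N_i}\sqrt{\omega_{ij}}\,\theta_{ij}(p_s)v_s(ij)=0$, $v_s(ij)=-v_s(ji)$, $t\le s\le T$, $p_t(i)=p_i$, equals $\mathcal U(p,t)$, and the Hamiltonian system above is the system of bi-characteristics of this Hamilton–Jacobi equation.
   Context: $\mathcal X=\{1,\dots,n\}$ and $\mathcal P(\mathcal X)=\{p\in\mathbb R^n:\ p_i\ge0,\ \sum_ip_i=1\}$. $Q$ is the generator of a reversible continuous-time Markov chain on $\mathcal X$ ($Q_{ij}\ge0$ for $j\ne i$, zero row sums) with unique positive invariant measure $\pi$ satisfying $Q_{ij}\pi_i=Q_{ji}\pi_j$. Put $\omega_{ij}=Q_{ij}\pi_i$, $E=\{(i,j):i\ne j,\ \omega_{ij}>0\}$, $\mathcal N_i=\{j:(i,j)\in E\}$, and $(\overline\nabla_\omega\Phi)_{i,j}=\sqrt{\omega_{ij}}(\Phi_j-\Phi_i)$. The activation function $\theta:\mathbb R^+\times\mathbb R^+\to\mathbb R^+$ satisfies (i) $\theta(x,y)=\theta(y,x)$; (ii) $\theta(x,y)>0$ if $xy\ne0$; (iii) $\theta\in C^1$; (iv) $\theta(x,y)=0$ if $xy=0$; and $\theta_{ij}(p)=\theta(p_i/\pi_i,p_j/\pi_j)$.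 For $(i,j)\in E$, $L_{ij}:\mathbb R\to\mathbb R$ satisfies $L_{ij}=L_{ji}$, $L_{ij}(-a)=L_{ij}(a)$, $L_{ij}(0)=0$, and is strictly convex and coercive (superlinear); $H_{ij}(b)=\sup_{a\in\mathbb R}(ab-L_{ij}(a))$ is its convex conjugate. $\mathcal F,\mathcal G\in C^1(\mathcal P(\mathcal X))$. Functions on $\mathcal P(\mathcal X)$ are treated as functions of the $n$ coordinates so that $\partial/\partial p_i$ and $\nabla_p$ make sense. The supremum is over continuously differentiable curves $p_s\in\mathcal P(\mathcal X)$ and vector fields $v_s=(v_s(ij))_{(i,j)\in E}$, $s\in[t,T]$. *)

theory Defs
  imports "HOL-Analysis.Analysis" "HOL-Library.Extended_Real"
begin

section \<open>Functions on the probability simplex, in coordinates\<close>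

definition prob_simplex :: "(real ^ 'n) set" where
  "prob_simplex = {p. (\<forall>i. 0 \<le> p $ i) \<and> (\<Sum>i\<in>UNIV. p $ i) = 1}"

definition nonneg_orthant :: "(real ^ 'n) set" where
  "nonneg_orthant = {p. \<forall>i. 0 \<le> p $ i}"

text \<open>A function on the simplex is treated as a function of the n coordinates, which range over the
  nonnegative orthant (the natural domain of the activation functions). It is of class C1 when, at
  each point of the set A of interest, it is differentiable relative to the ambient coordinate
  domain D, with a gradient that is continuous on A. No behaviour outside D is involved, and nothing
  is required at the points of D that are not in A.\<close>

definition C1_rel :: "('a::euclidean_space \<Rightarrow> real) \<Rightarrow> 'a set \<Rightarrow> 'a set \<Rightarrow> bool" where
  "C1_rel f A D \<longleftrightarrow>
     (\<exists>g. continuous_on A g \<and> (\<forall>x\<in>A. (f has_derivative (\<lambda>h. g x \<bullet> h)) (at x within D)))"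

definition set_coord :: "real ^ 'n \<Rightarrow> 'n \<Rightarrow> real \<Rightarrow> real ^ 'n" where
  "set_coord p i x = (\<chi> k. if k = i then x else p $ k)"

text \<open>Partial derivative in the i-th coordinate, that coordinate varying in S. We use
  \<open>S = {0..}\<close> for the variable p (one-sided derivative where the i-th coordinate vanishes) and
  \<open>S = UNIV\<close> for the variable \<open>\<Phi>\<close>.\<close>

definition partial_within :: "real set \<Rightarrow> (real ^ 'n \<Rightarrow> real) \<Rightarrow> 'n \<Rightarrow> real ^ 'n \<Rightarrow> real" where
  "partial_within S f i p = vector_derivative (\<lambda>x. f (set_coord p i x)) (at (p $ i) within S)"

definition grad_p :: "(real ^ 'n \<Rightarrow> real) \<Rightarrow> real ^ 'n \<Rightarrow> real ^ 'n" where
  "grad_p f p = (\<chi> i. partial_within {0..} f i p)"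

section \<open>The reversible Markov chain\<close>

definition generator :: "real ^ 'n ^ 'n \<Rightarrow> bool" where
  "generator Q \<longleftrightarrow> (\<forall>i j. i \<noteq> j \<longrightarrow> 0 \<le> Q $ i $ j) \<and> (\<forall>i. (\<Sum>j\<in>UNIV. Q $ i $ j) = 0)"

text \<open>Invariant measures are normalised to be probability vectors.\<close>

definition invariant_measure :: "real ^ 'n ^ 'n \<Rightarrow> real ^ 'n \<Rightarrow> bool" where
  "invariant_measure Q \<mu> \<longleftrightarrow> \<mu> \<in> prob_simplex \<and> (\<forall>j. (\<Sum>i\<in>UNIV. \<mu> $ i * Q $ i $ j) = 0)"

definition reversible :: "real ^ 'n ^ 'n \<Rightarrow> real ^ 'n \<Rightarrow> bool" where
  "reversible Q \<pi> \<longleftrightarrow> (\<forall>i j. Q $ i $ j * \<pi> $ i = Q $ j $ i * \<pi> $ j)"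

definition weight :: "real ^ 'n ^ 'n \<Rightarrow> real ^ 'n \<Rightarrow> 'n \<Rightarrow> 'n \<Rightarrow> real" where
  "weight Q \<pi> i j = Q $ i $ j * \<pi> $ i"

definition edges :: "real ^ 'n ^ 'n \<Rightarrow> real ^ 'n \<Rightarrow> ('n \<times> 'n) set" where
  "edges Q \<pi> = {(i, j). i \<noteq> j \<and> weight Q \<pi> i j > 0}"

definition nbrs :: "real ^ 'n ^ 'n \<Rightarrow> real ^ 'n \<Rightarrow> 'n \<Rightarrow> 'n set" where
  "nbrs Q \<pi> i = {j. (i, j) \<in> edges Q \<pi>}"

definition wgrad :: "real ^ 'n ^ 'n \<Rightarrow> real ^ 'n \<Rightarrow> real ^ 'n \<Rightarrow> 'n \<Rightarrow> 'n \<Rightarrow> real" where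
  "wgrad Q \<pi> \<Phi> i j = sqrt (weight Q \<pi> i j) * (\<Phi> $ j - \<Phi> $ i)"

section \<open>Activation function and Lagrangians\<close>

definition activation :: "(real \<Rightarrow> real \<Rightarrow> real) \<Rightarrow> bool" where
  "activation \<theta> \<longleftrightarrow>
     (\<forall>x\<ge>0. \<forall>y\<ge>0. 0 \<le> \<theta> x y) \<and>
     (\<forall>x\<ge>0. \<forall>y\<ge>0. \<theta> x y = \<theta> y x) \<and>
     (\<forall>x\<ge>0. \<forall>y\<ge>0. x * y \<noteq> 0 \<longrightarrow> 0 < \<theta> x y) \<and>
     C1_rel (\<lambda>(x, y). \<theta> x y) ({0..} \<times> {0..}) ({0..} \<times> {0..}) \<and>
     (\<forall>x\<ge>0. \<forall>y\<ge>0. x * y = 0 \<longrightarrow> \<theta> x y = 0)"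

definition theta_edge :: "real ^ 'n \<Rightarrow> (real \<Rightarrow> real \<Rightarrow> real) \<Rightarrow> 'n \<Rightarrow> 'n \<Rightarrow> real ^ 'n \<Rightarrow> real" where
  "theta_edge \<pi> \<theta> i j p = \<theta> (p $ i / \<pi> $ i) (p $ j / \<pi> $ j)"

definition strictly_convex :: "(real \<Rightarrow> real) \<Rightarrow> bool" where
  "strictly_convex f \<longleftrightarrow>
     (\<forall>a b u. a \<noteq> b \<longrightarrow> 0 < u \<longrightarrow> u < 1 \<longrightarrow> f (u * a + (1 - u) * b) < u * f a + (1 - u) * f b)"

definition superlinear :: "(real \<Rightarrow> real) \<Rightarrow> bool" where
  "superlinear f \<longleftrightarrow> filterlim (\<lambda>a. f a / \<bar>a\<bar>) at_top at_infinity"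

definition edge_lagrangians :: "('n \<times> 'n) set \<Rightarrow> ('n \<Rightarrow> 'n \<Rightarrow> real \<Rightarrow> real) \<Rightarrow> bool" where
  "edge_lagrangians E L \<longleftrightarrow>
     (\<forall>(i, j)\<in>E. L i j = L j i \<and> (\<forall>a. L i j (- a) = L i j a) \<and> L i j 0 = 0 \<and>
        strictly_convex (L i j) \<and> superlinear (L i j))"

text \<open>The supremum is finite for superlinear convex f, so the real-valued one can be used.\<close>

definition conjugate :: "(real \<Rightarrow> real) \<Rightarrow> real \<Rightarrow> real" where
  "conjugate f b = (SUP a. a * b - f a)"

section \<open>Hamiltonian, mean field game system, Hamiltonian systems\<close>

definition hamiltonian ::
  "real ^ 'n ^ 'n \<Rightarrow> real ^ 'n \<Rightarrow> (real \<Rightarrow> real \<Rightarrow> real) \<Rightarrow> ('n \<Rightarrow> 'n \<Rightarrow> real \<Rightarrow> real) \<Rightarrow>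
   (real ^ 'n \<Rightarrow> real) \<Rightarrow> real ^ 'n \<Rightarrow> real ^ 'n \<Rightarrow> real" where
  "hamiltonian Q \<pi> \<theta> L F p \<Phi> =
     1/2 * (\<Sum>(i, j)\<in>edges Q \<pi>. conjugate (L i j) (wgrad Q \<pi> \<Phi> i j) * theta_edge \<pi> \<theta> i j p) + F p"

definition mfg_system ::
  "real ^ 'n ^ 'n \<Rightarrow> real ^ 'n \<Rightarrow> (real \<Rightarrow> real \<Rightarrow> real) \<Rightarrow> ('n \<Rightarrow> 'n \<Rightarrow> real \<Rightarrow> real) \<Rightarrow>
   (real ^ 'n \<Rightarrow> real) \<Rightarrow> (real ^ 'n \<Rightarrow> real) \<Rightarrow> real \<Rightarrow> real \<Rightarrow> real ^ 'n \<Rightarrow>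
   (real \<Rightarrow> real ^ 'n) \<Rightarrow> (real \<Rightarrow> real ^ 'n) \<Rightarrow> bool" where
  "mfg_system Q \<pi> \<theta> L F G t T p0 p \<Phi> \<longleftrightarrow>
     (\<forall>s\<in>{t..T}. p s \<in> prob_simplex) \<and>
     (\<forall>s\<in>{t..T}. \<forall>i.
        ((\<lambda>r. p r $ i) has_real_derivative
          - (\<Sum>j\<in>nbrs Q \<pi> i. sqrt (weight Q \<pi> i j) * theta_edge \<pi> \<theta> i j (p s) *
               deriv (conjugate (L i j)) (wgrad Q \<pi> (\<Phi> s) i j)))
          (at s within {t..T})) \<and>
     (\<forall>s\<in>{t..T}. \<forall>i.
        ((\<lambda>r. \<Phi> r $ i) has_real_derivative
          - (\<Sum>j\<in>nbrs Q \<pi> i. conjugate (L i j) (wgrad Q \<pi> (\<Phi> s) i j) *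
               partial_within {0..} (theta_edge \<pi> \<theta> i j) i (p s))
          - partial_within {0..} F i (p s))
          (at s within {t..T})) \<and>
     p t = p0 \<and>
     (\<forall>i. \<Phi> T $ i = partial_within {0..} G i (p T))"

text \<open>Hamilton's equations for an arbitrary Hamiltonian H on the simplex times \<open>\<real>\<^sup>n\<close>.\<close>

definition hamiltonian_system ::
  "(real ^ 'n \<Rightarrow> real ^ 'n \<Rightarrow> real) \<Rightarrow> (real ^ 'n \<Rightarrow> real) \<Rightarrow> real \<Rightarrow> real \<Rightarrow> real ^ 'n \<Rightarrow>
   (real \<Rightarrow> real ^ 'n) \<Rightarrow> (real \<Rightarrow> real ^ 'n) \<Rightarrow> bool" where
  "hamiltonian_system H G t T p0 p \<Phi> \<longleftrightarrow>
     (\<forall>s\<in>{t..T}. p s \<in> prob_simplex) \<and>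
     (\<forall>s\<in>{t..T}. \<forall>i.
        ((\<lambda>r. p r $ i) has_real_derivative partial_within UNIV (\<lambda>\<Psi>. H (p s) \<Psi>) i (\<Phi> s))
          (at s within {t..T})) \<and>
     (\<forall>s\<in>{t..T}. \<forall>i.
        ((\<lambda>r. \<Phi> r $ i) has_real_derivative - partial_within {0..} (\<lambda>q. H q (\<Phi> s)) i (p s))
          (at s within {t..T})) \<and>
     p t = p0 \<and>
     (\<forall>i. \<Phi> T $ i = partial_within {0..} G i (p T))"

section \<open>Hamilton--Jacobi equation and its bi-characteristics\<close>

definition hj_classical_solution ::
  "(real ^ 'n \<Rightarrow> real ^ 'n \<Rightarrow> real) \<Rightarrow> (real ^ 'n \<Rightarrow> real) \<Rightarrow> real \<Rightarrow>
   (real ^ 'n \<Rightarrow> real \<Rightarrow> real) \<Rightarrow> bool" where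
  "hj_classical_solution H G T U \<longleftrightarrow>
     C1_rel (\<lambda>(p, t). U p t) (prob_simplex \<times> {..T}) (nonneg_orthant \<times> {..T}) \<and>
     (\<forall>p\<in>prob_simplex. \<forall>t\<le>T.
        vector_derivative (\<lambda>r. U p r) (at t within {..T}) + H p (grad_p (\<lambda>q. U q t) p) = 0) \<and>
     (\<forall>p\<in>prob_simplex. U p T = G p)"

text \<open>A first-order equation is given by its symbol \<open>S x t q \<tau>\<close>, where \<open>(q, \<tau>)\<close> stands for the
  covector dual to \<open>(x, t)\<close>: the equation is \<open>S x t (\<nabla>\<^sub>x u) (\<partial>\<^sub>t u) = 0\<close>. Its (null) bi-characteristics
  are the curves \<open>(x, t, q, \<tau>)\<close> in the zero set of S which are integral curves of the Hamiltonian
  vector field of S on the full phase space, time included.\<close>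

definition bicharacteristic ::
  "(real ^ 'n \<Rightarrow> real \<Rightarrow> real ^ 'n \<Rightarrow> real \<Rightarrow> real) \<Rightarrow> real set \<Rightarrow>
   (real \<Rightarrow> real ^ 'n) \<Rightarrow> (real \<Rightarrow> real) \<Rightarrow> (real \<Rightarrow> real ^ 'n) \<Rightarrow> (real \<Rightarrow> real) \<Rightarrow> bool" where
  "bicharacteristic S I x t q \<tau> \<longleftrightarrow>
     (\<forall>s\<in>I.
        S (x s) (t s) (q s) (\<tau> s) = 0 \<and>
        (\<forall>i. ((\<lambda>r. x r $ i) has_real_derivative
                partial_within UNIV (\<lambda>q'. S (x s) (t s) q' (\<tau> s)) i (q s)) (at s within I)) \<and>
        (t has_real_derivative deriv (\<lambda>\<tau>'. S (x s) (t s) (q s) \<tau>') (\<tau> s)) (at s within I) \<and>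
        (\<forall>i. ((\<lambda>r. q r $ i) has_real_derivative
                - partial_within {0..} (\<lambda>x'. S x' (t s) (q s) (\<tau> s)) i (x s)) (at s within I)) \<and>
        (\<tau> has_real_derivative - deriv (\<lambda>t'. S (x s) t' (q s) (\<tau> s)) (t s)) (at s within I))"

definition hj_symbol ::
  "(real ^ 'n \<Rightarrow> real ^ 'n \<Rightarrow> real) \<Rightarrow> real ^ 'n \<Rightarrow> real \<Rightarrow> real ^ 'n \<Rightarrow> real \<Rightarrow> real" where
  "hj_symbol H x t q \<tau> = \<tau> + H x q"

text \<open>Bi-characteristics of the Hamilton--Jacobi equation over the simplex, parametrised by time
  (possible since \<open>dt/ds = 1\<close> for this symbol), starting over the point \<open>p0\<close> and ending on the graph
  of the gradient of the terminal datum G.\<close>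

definition hj_bicharacteristic_system ::
  "(real ^ 'n \<Rightarrow> real ^ 'n \<Rightarrow> real) \<Rightarrow> (real ^ 'n \<Rightarrow> real) \<Rightarrow> real \<Rightarrow> real \<Rightarrow> real ^ 'n \<Rightarrow>
   (real \<Rightarrow> real ^ 'n) \<Rightarrow> (real \<Rightarrow> real ^ 'n) \<Rightarrow> bool" where
  "hj_bicharacteristic_system H G t T p0 p \<Phi> \<longleftrightarrow>
     (\<forall>s\<in>{t..T}. p s \<in> prob_simplex) \<and>
     (\<exists>\<tau>. bicharacteristic (hj_symbol H) {t..T} p (\<lambda>s. s) \<Phi> \<tau>) \<and>
     p t = p0 \<and>
     \<Phi> T = grad_p G (p T)"

section \<open>The control problem\<close>

definition running_cost ::
  "real ^ 'n ^ 'n \<Rightarrow> real ^ 'n \<Rightarrow> (real \<Rightarrow> real \<Rightarrow> real) \<Rightarrow> ('n \<Rightarrow> 'n \<Rightarrow> real \<Rightarrow> real) \<Rightarrow>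
   (real ^ 'n \<Rightarrow> real) \<Rightarrow> real ^ 'n \<Rightarrow> ('n \<Rightarrow> 'n \<Rightarrow> real) \<Rightarrow> real" where
  "running_cost Q \<pi> \<theta> L F p v =
     1/2 * (\<Sum>(i, j)\<in>edges Q \<pi>. theta_edge \<pi> \<theta> i j p * L i j (v i j)) - F p"

text \<open>No regularity in time is imposed on v beyond integrability of the running cost. The latter is
  bounded below along p, so the excluded pairs are those of infinite cost, and those for which the
  cost is not even measurable.\<close>

definition admissible ::
  "real ^ 'n ^ 'n \<Rightarrow> real ^ 'n \<Rightarrow> (real \<Rightarrow> real \<Rightarrow> real) \<Rightarrow> ('n \<Rightarrow> 'n \<Rightarrow> real \<Rightarrow> real) \<Rightarrow>
   (real ^ 'n \<Rightarrow> real) \<Rightarrow> real \<Rightarrow> real \<Rightarrow> real ^ 'n \<Rightarrow>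
   ((real \<Rightarrow> real ^ 'n) \<times> (real \<Rightarrow> 'n \<Rightarrow> 'n \<Rightarrow> real)) set" where
  "admissible Q \<pi> \<theta> L F t T p0 = {(p, v).
     (\<forall>s\<in>{t..T}. p s \<in> prob_simplex) \<and>
     (\<exists>p'. continuous_on {t..T} p' \<and>
        (\<forall>s\<in>{t..T}. (p has_vector_derivative p' s) (at s within {t..T}) \<and>
           (\<forall>i. p' s $ i +
              (\<Sum>j\<in>nbrs Q \<pi> i. sqrt (weight Q \<pi> i j) * theta_edge \<pi> \<theta> i j (p s) * v s i j) = 0))) \<and>
     (\<forall>s\<in>{t..T}. \<forall>(i, j)\<in>edges Q \<pi>. v s i j = - v s j i) \<and>
     (\<lambda>s. running_cost Q \<pi> \<theta> L F (p s) (v s)) integrable_on {t..T} \<and>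
     p t = p0}"

text \<open>The supremum is taken in the extended reals, so that equality with a real number carries the
  information that it is finite and that admissible pairs exist.\<close>

definition value_function ::
  "real ^ 'n ^ 'n \<Rightarrow> real ^ 'n \<Rightarrow> (real \<Rightarrow> real \<Rightarrow> real) \<Rightarrow> ('n \<Rightarrow> 'n \<Rightarrow> real \<Rightarrow> real) \<Rightarrow>
   (real ^ 'n \<Rightarrow> real) \<Rightarrow> (real ^ 'n \<Rightarrow> real) \<Rightarrow> real \<Rightarrow> real ^ 'n \<Rightarrow> real \<Rightarrow> ereal" where
  "value_function Q \<pi> \<theta> L F G T p0 t =
     (SUP (p, v) \<in> admissible Q \<pi> \<theta> L F t T p0.
        ereal (G (p T) - integral {t..T} (\<lambda>s. running_cost Q \<pi> \<theta> L F (p s) (v s))))"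

end

theory Submission
  imports Defs "HOL-Complex_Analysis.Great_Picard"
begin

text \<open>
  Everything about the dynamics comes from one derivative. Each \<open>L i j\<close> is strictly convex and
  superlinear, so its conjugate is differentiable and the derivative at \<open>b\<close> is the unique maximiser
  of \<open>a * b - L i j a\<close> (\<open>conjugate_DERIV\<close>), which moreover depends continuously on \<open>b\<close>.
  Hence the Hamiltonian is differentiable jointly in \<open>(p, \<Phi>)\<close>, one-sidedly at the boundary of the
  orthant. The symmetry of the weights, of \<open>\<theta>\<close> and of the Lagrangians under reversal of
  an edge turns the half-sum over edges into sums over neighbours (summation by parts), and the
  two components of the gradient are then exactly the right-hand sides of the mean field game system,
  up to sign (\<open>hamiltonian_has_derivative\<close>). By the chain rule the Hamiltonian is constant along its own
  flow, so \<open>\<tau> = - H\<close> completes every solution to a null bi-characteristic of \<open>\<tau> + H\<close>;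
  conversely the equations for the remaining components of a bi-characteristic are Hamilton's equations.

  The value function is identified by a verification argument. Along an admissible curve, the time
  derivative of \<open>U (p s) s\<close> is \<open>\<nabla>U \<bullet> p' - H(p, \<nabla>U)\<close> by the Hamilton--Jacobi equation. By the
  continuity equation and summation by parts, \<open>\<nabla>U \<bullet> p'\<close> is a half-sum over edges of
  \<open>\<theta>\<close> times a product of the gradient of \<open>U\<close> and the control, and the
  Fenchel--Young inequality bounds the derivative by the running cost. Integration gives the upper
  bound (\<open>payoff_le\<close>). Equality holds throughout for the feedback control \<open>v = H'(\<nabla>U)\<close>, so
  the supremum is attained as soon as the closed-loop equation for \<open>p\<close> has a solution in the simplex.

  Its right-hand side is only continuous, and only defined on the simplex. Existence is obtained from a
  version of Peano's theorem in a compact set that short Euler steps do not leave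
  (\<open>Peano_in_invariant_set\<close>): Euler polygons stay in the set, are equi-Lipschitz, and a uniform limit of
  them (Arzela--Ascoli) solves the equation. Euler steps preserve the simplex because
  the velocities sum to zero and, \<open>\<theta>\<close> being C1 and zero on the axes, the outflow from a vertex is at
  most a constant times the mass there (\<open>velocity_lower_bound\<close>).
\<close>

section \<open>Convex conjugates of strictly convex superlinear functions\<close>

text \<open>A convex function on the line is continuous, and superlinearity makes \<open>x * b - f x\<close> smaller than its
value at 0 outside a bounded interval, so the supremum is a maximum over a compact interval.\<close>

lemma conjugate_attained:
  assumes "strictly_convex f" "superlinear f"
  shows "\<exists>a. \<forall>x. x * b - f x \<le> a * b - f a"
proof -
  have "convex_on UNIV f"
  proof (rule convex_onI)
    fix u x y :: real assume "0 < u" "u < 1"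
    then show "f ((1 - u) *\<^sub>R x + u *\<^sub>R y) \<le> (1 - u) * f x + u * f y"
      using assms(1)[unfolded strictly_convex_def, rule_format, of y x u]
      by (cases "x = y") (auto simp: algebra_simps)
  qed simp
  then have cont: "continuous_on S f" for S
    using convex_on_continuous continuous_on_subset by blast
  have "\<forall>\<^sub>F x in at_infinity. \<bar>b\<bar> + \<bar>f 0\<bar> \<le> f x / \<bar>x\<bar>"
    using assms(2) unfolding superlinear_def filterlim_at_top by blast
  then obtain R where R: "\<And>x. R \<le> \<bar>x\<bar> \<Longrightarrow> \<bar>b\<bar> + \<bar>f 0\<bar> \<le> f x / \<bar>x\<bar>"
    by (auto simp: eventually_at_infinity)
  define M where "M = max R 1"
  have far: "x * b - f x \<le> 0 * b - f 0" if "M \<le> \<bar>x\<bar>" for x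
  proof -
    have x: "R \<le> \<bar>x\<bar>" "1 \<le> \<bar>x\<bar>" using that by (auto simp: M_def)
    then have "(\<bar>b\<bar> + \<bar>f 0\<bar>) * \<bar>x\<bar> \<le> f x"
      using R[OF x(1)] by (simp add: pos_le_divide_eq)
    moreover have "x * b \<le> \<bar>b\<bar> * \<bar>x\<bar>" by (metis abs_ge_self abs_mult mult.commute)
    moreover have "\<bar>f 0\<bar> * 1 \<le> \<bar>f 0\<bar> * \<bar>x\<bar>" using x(2) by (intro mult_left_mono) auto
    ultimately show ?thesis by (simp add: algebra_simps)
  qed
  have "\<exists>a\<in>{-M..M}. \<forall>x\<in>{-M..M}. x * b - f x \<le> a * b - f a"
    by (rule continuous_attains_sup) (auto intro!: continuous_intros cont simp: M_def)
  then obtain a where a: "\<And>x. x \<in> {-M..M} \<Longrightarrow> x * b - f x \<le> a * b - f a" by blast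
  have "0 * b - f 0 \<le> a * b - f a" by (rule a) (auto simp: M_def)
  then have "x * b - f x \<le> a * b - f a" for x
    using a[of x] far[of x] by (cases "M \<le> \<bar>x\<bar>") (auto simp: not_le abs_less_iff)
  then show ?thesis by blast
qed

definition conj_argmax :: "(real \<Rightarrow> real) \<Rightarrow> real \<Rightarrow> real" where
  "conj_argmax f b = (SOME a. \<forall>x. x * b - f x \<le> a * b - f a)"

lemma conj_argmax_max:
  assumes "strictly_convex f" "superlinear f"
  shows "x * b - f x \<le> conj_argmax f b * b - f (conj_argmax f b)"
  using someI_ex[OF conjugate_attained[OF assms, of b]] unfolding conj_argmax_def by blast

lemma conjugate_eq_argmax:
  assumes "strictly_convex f" "superlinear f"
  shows "conjugate f b = conj_argmax f b * b - f (conj_argmax f b)"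
  unfolding conjugate_def
  by (rule cSup_eq_maximum) (auto intro: conj_argmax_max[OF assms])

lemma Fenchel_Young:
  assumes "strictly_convex f" "superlinear f"
  shows "x * b \<le> f x + conjugate f b"
  using conj_argmax_max[OF assms, of x b] conjugate_eq_argmax[OF assms, of b] by simp

text \<open>Strict convexity makes the maximiser \<open>a\<close> a strict minimum of \<open>\<phi> x = f x - x * b\<close>; by convexity \<open>\<phi>\<close> then grows at
least linearly, with some slope \<open>c / e\<close>, at distances of at least \<open>e\<close> from \<open>a\<close>. Changing \<open>b\<close> by less than this
slope cannot move the maximiser that far.\<close>

lemma conj_argmax_isCont:
  assumes "strictly_convex f" "superlinear f"
  shows "isCont (conj_argmax f) b"
  unfolding continuous_at_eps_delta
proof (intro allI impI)
  fix e :: real assume e: "0 < e"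
  define a where "a = conj_argmax f b"
  define \<phi> where "\<phi> x = f x - x * b" for x
  have strict: "\<phi> a < \<phi> x" if "x \<noteq> a" for x
  proof -
    have "f (1/2 * x + (1 - 1/2) * a) < 1/2 * f x + (1 - 1/2) * f a"
      using assms(1) that unfolding strictly_convex_def by (metis half_gt_zero_iff zero_less_one field_sum_of_halves less_add_same_cancel1)
    moreover have "\<phi> a \<le> \<phi> (1/2 * x + (1 - 1/2) * a)"
      using conj_argmax_max[OF assms, of "1/2 * x + (1 - 1/2) * a" b] by (simp add: \<phi>_def a_def)
    ultimately show ?thesis by (simp add: \<phi>_def algebra_simps)
  qed
  define c where "c = min (\<phi> (a + e)) (\<phi> (a - e)) - \<phi> a"
  have c: "0 < c" using strict[of "a + e"] strict[of "a - e"] e by (auto simp: c_def)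
  have growth: "\<phi> a + c * (\<bar>x - a\<bar> / e) \<le> \<phi> x" if x: "e \<le> \<bar>x - a\<bar>" for x
  proof -
    \<comment> \<open>\<open>z\<close> is the point of the segment from \<open>a\<close> to \<open>x\<close> at distance \<open>e\<close> from \<open>a\<close>.\<close>
    define u where "u = e / \<bar>x - a\<bar>"
    have u: "0 < u" "u \<le> 1" using x e by (auto simp: u_def)
    define z where "z = u * x + (1 - u) * a"
    have "z - a = u * (x - a)" by (simp add: z_def algebra_simps)
    then have "\<bar>z - a\<bar> = e" using x e by (simp add: abs_mult u_def)
    then have "z = a + e \<or> z = a - e" by linarith
    then have "c \<le> \<phi> z - \<phi> a" by (auto simp: c_def)
    moreover have "f z \<le> u * f x + (1 - u) * f a"
    proof (cases "u = 1")
      case True then show ?thesis by (simp add: z_def)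
    next
      case False
      have "x \<noteq> a" using x e by auto
      then show ?thesis
        using assms(1)[unfolded strictly_convex_def, rule_format, of x a u] u False
        by (auto simp: z_def)
    qed
    then have "\<phi> z - \<phi> a \<le> u * (\<phi> x - \<phi> a)" by (simp add: \<phi>_def z_def algebra_simps)
    ultimately have "c \<le> u * (\<phi> x - \<phi> a)" by linarith
    then have "c / u \<le> \<phi> x - \<phi> a" using u by (simp add: pos_divide_le_eq mult.commute)
    then show ?thesis by (simp add: u_def)
  qed
  show "\<exists>d>0. \<forall>b'. dist b' b < d \<longrightarrow> dist (conj_argmax f b') (conj_argmax f b) < e"
  proof (intro exI[of _ "c / e"] conjI allI impI)
    show "0 < c / e" using c e by simp
    fix b' assume b': "dist b' b < c / e"
    define x where "x = conj_argmax f b'"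
    show "dist (conj_argmax f b') (conj_argmax f b) < e"
    proof (rule ccontr)
      assume "\<not> ?thesis"
      then have x: "e \<le> \<bar>x - a\<bar>" by (simp add: x_def a_def dist_real_def)
      have "a * b' - f a \<le> x * b' - f x" unfolding x_def by (rule conj_argmax_max[OF assms])
      then have "\<phi> x - \<phi> a \<le> (x - a) * (b' - b)" by (simp add: \<phi>_def algebra_simps)
      also have "\<dots> \<le> \<bar>x - a\<bar> * \<bar>b' - b\<bar>" by (metis abs_ge_self abs_mult)
      also have "\<dots> < \<bar>x - a\<bar> * (c / e)"
        using b' x e by (intro mult_strict_left_mono) (auto simp: dist_real_def)
      finally show False using growth[OF x] by (simp add: mult.commute)
    qed
  qed
qed

text \<open>Maximisers are subgradients of the conjugate. Comparing the subgradient inequalities at \<open>b\<close> and \<open>y\<close>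
squeezes the difference quotient between the maximisers at \<open>b\<close> and at \<open>y\<close>, and these merge by continuity.\<close>

lemma conjugate_DERIV:
  assumes "strictly_convex f" "superlinear f"
  shows "(conjugate f has_real_derivative conj_argmax f b) (at b)"
proof -
  let ?m = "conj_argmax f"
  have sub: "conjugate f c + ?m c * (d - c) \<le> conjugate f d" for c d
    using conj_argmax_max[OF assms, of "?m c" d]
    by (simp add: conjugate_eq_argmax[OF assms] algebra_simps)
  have "(\<lambda>y. (conjugate f y - conjugate f b) / (y - b)) \<midarrow>b\<rightarrow> ?m b"
  proof (rule metric_LIM_I)
    fix e :: real assume "0 < e"
    then obtain d where d: "0 < d" "\<And>y. dist y b < d \<Longrightarrow> dist (?m y) (?m b) < e"
      using conj_argmax_isCont[OF assms, of b] unfolding continuous_at_eps_delta by blast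
    have "dist ((conjugate f y - conjugate f b) / (y - b)) (?m b) < e"
      if y: "y \<noteq> b" "dist y b < d" for y
    proof -
      let ?q = "(conjugate f y - conjugate f b) / (y - b)"
      have "?m b * (y - b) \<le> conjugate f y - conjugate f b"
        "conjugate f y - conjugate f b \<le> ?m y * (y - b)"
        using sub[of b y] sub[of y b] by (auto simp: algebra_simps)
      then have "?m b \<le> ?q \<and> ?q \<le> ?m y \<or> ?m y \<le> ?q \<and> ?q \<le> ?m b"
        using y(1) by (cases "b < y")
          (auto simp: pos_le_divide_eq pos_divide_le_eq neg_le_divide_eq neg_divide_le_eq)
      then have "\<bar>?q - ?m b\<bar> \<le> \<bar>?m y - ?m b\<bar>" by linarith
      then show ?thesis using d(2)[OF y(2)] by (simp add: dist_real_def)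
    qed
    then show "\<exists>d>0. \<forall>y. y \<noteq> b \<and> dist y b < d \<longrightarrow>
        dist ((conjugate f y - conjugate f b) / (y - b)) (?m b) < e" using d(1) by blast
  qed
  then show ?thesis by (simp add: has_field_derivative_iff)
qed

lemma conjugate_even:
  assumes "\<And>a. f (- a) = f a"
  shows "conjugate f (- b) = conjugate f b"
proof -
  have "range (\<lambda>a. a * - b - f a) = range (\<lambda>a. a * b - f a)"
    using assms by (auto simp: image_iff) (metis minus_mult_minus minus_minus mult_minus_left)+
  then show ?thesis by (simp add: conjugate_def)
qed

lemma conj_argmax_odd:
  assumes "strictly_convex f" "superlinear f" "\<And>a. f (- a) = f a"
  shows "conj_argmax f (- b) = - conj_argmax f b"
proof -
  have "((\<lambda>x. conjugate f (- x)) has_real_derivative conj_argmax f (- b) * - 1) (at b)"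
    by (rule DERIV_chain2[OF conjugate_DERIV[OF assms(1,2)]]) (auto intro!: derivative_eq_intros)
  then have "(conjugate f has_real_derivative - conj_argmax f (- b)) (at b)"
    by (simp add: conjugate_even[of f, OF assms(3)])
  then show ?thesis using DERIV_unique conjugate_DERIV[OF assms(1,2)] by fastforce
qed

section \<open>Peano's theorem in a compact invariant set\<close>

primrec euler_node :: "(real \<Rightarrow> 'a::real_vector \<Rightarrow> 'a) \<Rightarrow> real \<Rightarrow> real \<Rightarrow> 'a \<Rightarrow> nat \<Rightarrow> 'a" where
  "euler_node f t h x 0 = x"
| "euler_node f t h x (Suc k) = euler_node f t h x k + h *\<^sub>R f (t + real k * h) (euler_node f t h x k)"

text \<open>The weight of the k-th slope is the length of the part of the k-th grid cell that lies to the left of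
\<open>s\<close>. Written in this way, without locating the cell of \<open>s\<close>, the polygon has increments that are
combinations of the slopes with nonnegative weights of total \<open>b - a\<close>.\<close>

definition euler_polygon ::
  "(real \<Rightarrow> 'a::real_vector \<Rightarrow> 'a) \<Rightarrow> real \<Rightarrow> real \<Rightarrow> 'a \<Rightarrow> nat \<Rightarrow> real \<Rightarrow> 'a" where
  "euler_polygon f t h x n s =
     x + (\<Sum>k<n. (min s (t + real (Suc k) * h) - min s (t + real k * h)) *\<^sub>R
                   f (t + real k * h) (euler_node f t h x k))"

lemma min_grid_telescope:
  fixes t h s :: real
  assumes "t \<le> s" "s \<le> t + real n * h"
  shows "(\<Sum>k<n. min s (t + real (Suc k) * h) - min s (t + real k * h)) = s - t"
  using sum_lessThan_telescope[of "\<lambda>k. min s (t + real k * h)" n] assms by simp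

lemma euler_polygon_after:
  assumes "0 \<le> h" "t + real n * h \<le> s"
  shows "euler_polygon f t h x n s = euler_node f t h x n"
  using assms(2)
proof (induction n)
  case 0 then show ?case by (simp add: euler_polygon_def)
next
  case (Suc n)
  have "t + real n * h \<le> s" using Suc.prems assms(1) by (simp add: algebra_simps)
  then show ?case using Suc.IH Suc.prems
    by (simp add: euler_polygon_def min_absorb2 algebra_simps)
qed

lemma euler_polygon_before:
  assumes "0 \<le> h" "k \<le> n" "s \<le> t + real k * h"
  shows "euler_polygon f t h x n s = euler_polygon f t h x k s"
  using assms(2)
proof (induction n rule: dec_induct)
  case base then show ?case by simp
next
  case (step n)
  have "real k * h \<le> real n * h" "real k * h \<le> real (Suc n) * h"
    using step.hyps assms(1) by (auto intro!: mult_right_mono)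
  then have "s \<le> t + real n * h" "s \<le> t + real (Suc n) * h" using assms(3) by linarith+
  then show ?case using step.IH by (simp add: euler_polygon_def min_absorb1)
qed

lemma euler_polygon_on_cell:
  assumes "0 \<le> h" "k < n" "t + real k * h \<le> s" "s \<le> t + real (Suc k) * h"
  shows "euler_polygon f t h x n s =
    euler_node f t h x k + (s - (t + real k * h)) *\<^sub>R f (t + real k * h) (euler_node f t h x k)"
proof -
  have "euler_polygon f t h x n s = euler_polygon f t h x (Suc k) s"
    using assms by (intro euler_polygon_before) auto
  also have "\<dots> = euler_polygon f t h x k s +
      (s - (t + real k * h)) *\<^sub>R f (t + real k * h) (euler_node f t h x k)"
    using assms by (simp add: euler_polygon_def min_absorb1 min_absorb2 add.assoc)
  also have "euler_polygon f t h x k s = euler_node f t h x k"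
    using assms by (intro euler_polygon_after) auto
  finally show ?thesis .
qed

lemma grid_cell:
  fixes t h s :: real
  assumes "0 < n" "t \<le> s" "s \<le> t + real n * h"
  shows "\<exists>k<n. t + real k * h \<le> s \<and> s \<le> t + real (Suc k) * h"
  using assms
proof (induction n)
  case (Suc n)
  show ?case
  proof (cases "t + real n * h \<le> s")
    case True then show ?thesis using Suc.prems by blast
  next
    case False
    then have "0 < n" using Suc.prems by (cases n) auto
    then show ?thesis using Suc.IH Suc.prems False less_Suc_eq by auto
  qed
qed simp

text \<open>The only slopes that contribute to the increment over \<open>[a, b]\<close> are those of the cells that meet
\<open>[a, b]\<close>. With \<open>v = 0\<close> this is the Lipschitz bound, and with \<open>v\<close> the field at a point of the curve it
says that the polygon is an approximate solution.\<close>

lemma euler_polygon_increment: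
  fixes f :: "real \<Rightarrow> 'a::real_normed_vector \<Rightarrow> 'a"
  assumes "0 \<le> h" "t \<le> a" "a \<le> b" "b \<le> t + real n * h"
    and near: "\<And>k. k < n \<Longrightarrow> t + real k * h \<le> b \<Longrightarrow> a \<le> t + real (Suc k) * h \<Longrightarrow>
                 norm (f (t + real k * h) (euler_node f t h x k) - v) \<le> e"
  shows "norm (euler_polygon f t h x n b - euler_polygon f t h x n a - (b - a) *\<^sub>R v) \<le> e * (b - a)"
proof -
  define c where "c s k = min s (t + real (Suc k) * h) - min s (t + real k * h)" for s k
  define w where "w k = c b k - c a k" for k
  define g where "g k = f (t + real k * h) (euler_node f t h x k)" for k
  have sum_w: "(\<Sum>k<n. w k) = b - a"
    using min_grid_telescope[of t b n h] min_grid_telescope[of t a n h] assms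
    by (simp add: w_def c_def sum_subtractf)
  have grid: "t + real k * h \<le> t + real (Suc k) * h" for k
    using assms(1) by (simp add: algebra_simps)
  have w_nonneg: "0 \<le> w k" for k
    using grid[of k] assms(3) by (auto simp: w_def c_def min_def)
  have w_zero: "w k = 0" if "\<not> (t + real k * h \<le> b \<and> a \<le> t + real (Suc k) * h)" for k
    using that grid[of k] assms(3) by (auto simp: w_def c_def min_def)
  have "euler_polygon f t h x n s = x + (\<Sum>k<n. c s k *\<^sub>R g k)" for s
    by (simp add: euler_polygon_def g_def c_def)
  then have "euler_polygon f t h x n b - euler_polygon f t h x n a - (b - a) *\<^sub>R v
      = (\<Sum>k<n. w k *\<^sub>R (g k - v))"
    unfolding sum_w[symmetric]
    by (simp add: w_def scaleR_sum_left sum_subtractf[symmetric] algebra_simps)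
  also have "norm \<dots> \<le> (\<Sum>k<n. w k * e)"
  proof (intro sum_norm_le)
    fix k assume "k \<in> {..<n}"
    then show "norm (w k *\<^sub>R (g k - v)) \<le> w k * e"
      using near[of k] w_nonneg[of k] w_zero[of k] by (cases "w k = 0") (auto simp: g_def intro!: mult_left_mono)
  qed
  also have "\<dots> = e * (b - a)" by (simp add: sum_w[symmetric] sum_distrib_left mult.commute)
  finally show ?thesis .
qed

text \<open>Only continuity on the compact set is available, so uniqueness fails in general; the
condition \<open>inv\<close> replaces an extension of the field beyond \<open>K\<close> and keeps the whole construction inside \<open>K\<close>.\<close>

theorem Peano_in_invariant_set:
  fixes f :: "real \<Rightarrow> 'a::euclidean_space \<Rightarrow> 'a"
  assumes "t \<le> T" "compact K" "x \<in> K"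
    and cont: "continuous_on ({t..T} \<times> K) (\<lambda>(s, x). f s x)"
    and "0 < h0"
    and inv: "\<And>s y h. s \<in> {t..T} \<Longrightarrow> y \<in> K \<Longrightarrow> 0 \<le> h \<Longrightarrow> h \<le> h0 \<Longrightarrow> y + h *\<^sub>R f s y \<in> K"
  obtains p where "p t = x" "\<And>s. s \<in> {t..T} \<Longrightarrow> p s \<in> K"
    "\<And>s. s \<in> {t..T} \<Longrightarrow> (p has_vector_derivative f s (p s)) (at s within {t..T})"
proof -
  \<comment> \<open>The m-th polygon has \<open>N m\<close> cells; the offset \<open>N0\<close> makes all steps at most \<open>h0\<close>.\<close>
  obtain N0 :: nat where N0: "(T - t) / h0 < real N0" using reals_Archimedean2 by blast
  define N where "N m = Suc (N0 + m)" for m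
  define h where "h m = (T - t) / real (N m)" for m
  define P where "P m = euler_polygon f t (h m) x (N m)" for m
  define X where "X m = euler_node f t (h m) x" for m
  define \<sigma> where "\<sigma> m k = t + real k * h m" for m k
  have h_nonneg: "0 \<le> h m" for m using assms(1) by (simp add: h_def)
  have h_le: "h m \<le> h0" for m
  proof -
    have "T - t \<le> h0 * real N0" using N0 \<open>0 < h0\<close> by (simp add: pos_divide_less_eq mult.commute)
    also have "\<dots> \<le> h0 * real (N m)" using \<open>0 < h0\<close> by (intro mult_left_mono) (auto simp: N_def)
    finally show ?thesis by (simp add: h_def N_def pos_divide_le_eq)
  qed
  have end_grid: "t + real (N m) * h m = T" for m by (simp add: h_def N_def)
  have \<sigma>_mem: "\<sigma> m k \<in> {t..T}" if "k \<le> N m" for m k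
  proof -
    have "real k * h m \<le> real (N m) * h m" using that h_nonneg by (intro mult_right_mono) auto
    then show ?thesis using h_nonneg[of m] end_grid[of m] by (auto simp: \<sigma>_def)
  qed
  have X_mem: "X m k \<in> K" if "k \<le> N m" for m k
    using that
  proof (induction k)
    case 0 then show ?case using assms(3) by (simp add: X_def)
  next
    case (Suc k) then show ?case
      using inv[OF \<sigma>_mem[of k m], of "X m k" "h m"] h_nonneg h_le by (simp add: X_def \<sigma>_def)
  qed
  have P_node: "P m (\<sigma> m k) = X m k" if "k \<le> N m" for m k
    by (simp add: P_def X_def \<sigma>_def euler_polygon_before[OF h_nonneg that] euler_polygon_after h_nonneg)
  have P_mem: "P m s \<in> K" if s: "s \<in> {t..T}" for m s
  proof -
    obtain k where k: "k < N m" "\<sigma> m k \<le> s" "s \<le> \<sigma> m (Suc k)"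
      using grid_cell[of "N m" t s "h m"] s end_grid[of m] by (auto simp: N_def \<sigma>_def)
    have "P m s = X m k + (s - \<sigma> m k) *\<^sub>R f (\<sigma> m k) (X m k)"
      using euler_polygon_on_cell[OF h_nonneg k(1), of t m s] k by (simp add: P_def X_def \<sigma>_def)
    moreover have "s - \<sigma> m k \<le> h m" using k(3) by (simp add: \<sigma>_def algebra_simps)
    ultimately show ?thesis
      using inv[OF \<sigma>_mem[of k m] X_mem[of k m], of "s - \<sigma> m k"] k h_le[of m] by simp
  qed
  have incr: "norm (P m b - P m a - (b - a) *\<^sub>R v) \<le> e * (b - a)"
    if "a \<in> {t..T}" "b \<in> {t..T}" "a \<le> b"
      "\<And>k. k < N m \<Longrightarrow> \<sigma> m k \<le> b \<Longrightarrow> a \<le> \<sigma> m k + h m \<Longrightarrow> norm (f (\<sigma> m k) (X m k) - v) \<le> e" for m a b v e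
    unfolding P_def
  proof (rule euler_polygon_increment[OF h_nonneg])
    show "t \<le> a" "a \<le> b" "b \<le> t + real (N m) * h m" using that end_grid[of m] by auto
    fix k assume "k < N m" "t + real k * h m \<le> b" "a \<le> t + real (Suc k) * h m"
    then show "norm (f (t + real k * h m) (euler_node f t (h m) x k) - v) \<le> e"
      using that(4)[of k] by (simp add: \<sigma>_def X_def algebra_simps)
  qed
  have cK: "compact ({t..T} \<times> K)" using assms(2) by (intro compact_Times) auto
  have "bounded ((\<lambda>(s, x). f s x) ` ({t..T} \<times> K))"
    by (intro compact_imp_bounded compact_continuous_image cont cK)
  then obtain M where M: "0 < M" "\<And>s y. s \<in> {t..T} \<Longrightarrow> y \<in> K \<Longrightarrow> norm (f s y) \<le> M"
    unfolding bounded_pos by force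
  have lip0: "norm (P m b - P m a) \<le> M * (b - a)" if "a \<in> {t..T}" "b \<in> {t..T}" "a \<le> b" for m a b
    using incr[OF that, of m 0 M] M(2) \<sigma>_mem X_mem by simp
  have lip: "norm (P m b - P m a) \<le> M * \<bar>b - a\<bar>" if "a \<in> {t..T}" "b \<in> {t..T}" for m a b
    using lip0[OF that, of m] lip0[OF that(2,1), of m] by (cases "a \<le> b") (auto simp: norm_minus_commute)
  have "bounded K" using assms(2) by (rule compact_imp_bounded)
  then obtain BK where BK: "\<And>y. y \<in> K \<Longrightarrow> norm y \<le> BK" unfolding bounded_iff by blast
  obtain p r where pr: "continuous_on {t..T} p" "strict_mono (r :: nat \<Rightarrow> nat)"
    "\<And>e. 0 < e \<Longrightarrow> \<exists>N. \<forall>n s. n \<ge> N \<and> s \<in> {t..T} \<longrightarrow> norm (P (r n) s - p s) < e"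
  proof (rule Arzela_Ascoli[of "{t..T}" P BK])
    show "\<And>m s. s \<in> {t..T} \<Longrightarrow> norm (P m s) \<le> BK" using BK P_mem by blast
    fix s e :: real assume s: "s \<in> {t..T}" and e: "0 < e"
    have "norm (P m s - P m y) < e" if "y \<in> {t..T}" "norm (s - y) < e / M" for m y
    proof -
      have "norm (P m s - P m y) \<le> M * \<bar>s - y\<bar>" using lip s that by blast
      also have "\<dots> < M * (e / M)" using that M(1) by (intro mult_strict_left_mono) auto
      finally show ?thesis using M(1) by simp
    qed
    then show "\<exists>d>0. \<forall>m y. y \<in> {t..T} \<and> norm (s - y) < d \<longrightarrow> norm (P m s - P m y) < e"
      using e M(1) by (intro exI[of _ "e / M"]) auto
  qed (use that in auto)
  have lim: "(\<lambda>n. P (r n) s) \<longlonglongrightarrow> p s" if "s \<in> {t..T}" for s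
    unfolding LIMSEQ_iff using pr(3) that by blast
  have p_mem: "p s \<in> K" if "s \<in> {t..T}" for s
    using closed_sequentially[OF compact_imp_closed[OF assms(2)] _ lim[OF that]] P_mem[OF that] by blast
  have "P m t = x" for m
    using P_node[of 0 m] by (simp add: \<sigma>_def X_def)
  then have p_init: "p t = x" using lim[of t] assms(1) by (simp add: LIMSEQ_const_iff)
  have h_lim: "h \<longlonglongrightarrow> 0"
    unfolding h_def N_def
    by (rule tendsto_divide_0[OF tendsto_const])
       (rule filterlim_at_top_imp_at_infinity, rule filterlim_compose[OF filterlim_real_sequentially],
        rule filterlim_compose[OF filterlim_Suc], rule filterlim_at_top_mono[OF filterlim_ident], auto)
  have unif: "uniformly_continuous_on ({t..T} \<times> K) (\<lambda>(s, x). f s x)"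
    by (rule compact_uniformly_continuous[OF cont cK])
  have f_lim: "(\<lambda>n. f c (P (r n) c)) \<longlonglongrightarrow> f c (p c)" if c: "c \<in> {t..T}" for c
  proof -
    have sub: "Pair c ` K \<subseteq> {t..T} \<times> K" using c by auto
    have "continuous_on K (f c)"
      using continuous_on_compose2[OF cont continuous_on_Pair[OF continuous_on_const continuous_on_id] sub]
      by simp
    then show ?thesis
      by (rule continuous_on_tendsto_compose[OF _ lim[OF c] p_mem[OF c]]) (simp add: P_mem[OF c])
  qed
  have slope: "\<exists>d>0. \<forall>y\<in>{t..T}. norm (y - c) < d \<longrightarrow>
      norm (p y - p c - (y - c) *\<^sub>R f c (p c)) \<le> e * norm (y - c)"
    if c: "c \<in> {t..T}" and e: "0 < e" for c e
  proof -
    obtain d where d: "0 < d" "\<And>s s' y y'. s \<in> {t..T} \<Longrightarrow> y \<in> K \<Longrightarrow> s' \<in> {t..T} \<Longrightarrow> y' \<in> K \<Longrightarrow>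
        dist (s', y') (s, y) < d \<Longrightarrow> dist (f s' y') (f s y) < e"
      using unif e unfolding uniformly_continuous_on_def by fastforce
    \<comment> \<open>The nodes that influence the polygon near \<open>c\<close> are at times within \<open>2 * \<delta>\<close> of \<open>c\<close>, hence,
      by the Lipschitz bound, within \<open>(1 + M) * 2 * \<delta> = d\<close> of \<open>(c, P m c)\<close> in space-time.\<close>
    define \<delta> where "\<delta> = d / (2 * (1 + M))"
    have \<delta>: "0 < \<delta>" using d(1) M(1) by (simp add: \<delta>_def)
    have main: "norm (P m b - P m a - (b - a) *\<^sub>R f c (P m c)) \<le> e * (b - a)"
      if "a \<in> {t..T}" "b \<in> {t..T}" "a \<le> c" "c \<le> b" "b - a < \<delta>" "h m < \<delta>" for m a b
    proof (rule incr)
      fix k assume k: "k < N m" "\<sigma> m k \<le> b" "a \<le> \<sigma> m k + h m"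
      have mem: "\<sigma> m k \<in> {t..T}" using k \<sigma>_mem by auto
      have close: "\<bar>\<sigma> m k - c\<bar> < 2 * \<delta>" using k that h_nonneg[of m] by (auto simp: abs_if)
      have "dist (\<sigma> m k, X m k) (c, P m c) \<le> \<bar>\<sigma> m k - c\<bar> + norm (X m k - P m c)"
        using norm_Pair_le[of "\<sigma> m k - c" "X m k - P m c"] by (simp add: dist_norm)
      also have "\<dots> \<le> \<bar>\<sigma> m k - c\<bar> + M * \<bar>\<sigma> m k - c\<bar>"
        using lip[OF c mem, of m] P_node[of k m] k(1) by simp
      also have "\<dots> = (1 + M) * \<bar>\<sigma> m k - c\<bar>" by (simp add: algebra_simps)
      also have "\<dots> < (1 + M) * (2 * \<delta>)" using close M(1) by (intro mult_strict_left_mono) auto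
      also have "\<dots> = d" using M(1) by (simp add: \<delta>_def field_simps)
      finally show "norm (f (\<sigma> m k) (X m k) - f c (P m c)) \<le> e"
        using d(2)[OF c P_mem[OF c] mem X_mem[of k m]] k(1) by (simp add: dist_norm less_imp_le)
    qed (use that in auto)
    have ev: "\<forall>\<^sub>F n in sequentially. h (r n) < \<delta>"
      using order_tendstoD(2)[OF LIMSEQ_subseq_LIMSEQ[OF h_lim pr(2)] \<delta>] by (simp add: o_def)
    have "norm (p y - p c - (y - c) *\<^sub>R f c (p c)) \<le> e * norm (y - c)"
      if y: "y \<in> {t..T}" "norm (y - c) < \<delta>" for y
    proof (rule tendsto_upperbound)
      show "(\<lambda>n. norm (P (r n) y - P (r n) c - (y - c) *\<^sub>R f c (P (r n) c)))
          \<longlonglongrightarrow> norm (p y - p c - (y - c) *\<^sub>R f c (p c))"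
        by (intro tendsto_intros lim y c f_lim)
      show "\<forall>\<^sub>F n in sequentially. norm (P (r n) y - P (r n) c - (y - c) *\<^sub>R f c (P (r n) c))
          \<le> e * norm (y - c)"
        using ev
      proof eventually_elim
        case (elim n)
        show ?case
        proof (cases "c \<le> y")
          case True then show ?thesis using main[of c y "r n"] c y elim by auto
        next
          case False
          have "P (r n) y - P (r n) c - (y - c) *\<^sub>R f c (P (r n) c)
              = - (P (r n) c - P (r n) y - (c - y) *\<^sub>R f c (P (r n) c))" by (simp add: algebra_simps)
          then show ?thesis using main[of y c "r n"] c y elim False by (simp only: norm_minus_cancel) auto
        qed
      qed
    qed simp
    then show ?thesis using \<delta> by blast
  qed
  have "(p has_vector_derivative f s (p s)) (at s within {t..T})" if "s \<in> {t..T}" for s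
    unfolding has_vector_derivative_def has_derivative_within_alt
    using slope[OF that] by (auto intro!: bounded_linear_intros)
  then show ?thesis using that p_init p_mem by blast
qed

section \<open>Partial derivatives on the simplex\<close>

lemma prob_simplex_subset_orthant: "prob_simplex \<subseteq> nonneg_orthant"
  by (auto simp: prob_simplex_def nonneg_orthant_def)

lemma compact_prob_simplex: "compact (prob_simplex :: (real ^ 'n) set)"
proof -
  have "closed (prob_simplex :: (real ^ 'n) set)"
    unfolding prob_simplex_def
    by (intro closed_Collect_conj closed_Collect_all closed_Collect_le closed_Collect_eq continuous_intros)
  moreover have "bounded (prob_simplex :: (real ^ 'n) set)"
  proof (rule boundedI)
    fix p :: "real ^ 'n" assume "p \<in> prob_simplex"
    then show "norm p \<le> 1" using norm_le_l1_cart[of p] by (simp add: prob_simplex_def)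
  qed
  ultimately show ?thesis by (simp add: compact_eq_bounded_closed)
qed

lemma prob_simplex_nth_le: "p \<in> prob_simplex \<Longrightarrow> p $ i \<le> 1"
  using member_le_sum[of i UNIV "\<lambda>i. p $ i"] by (auto simp: prob_simplex_def)

lemma at_within_atLeast_nontrivial:
  fixes a x :: real assumes "a \<le> x" shows "at x within {a..} \<noteq> bot"
proof -
  have "x islimpt {a..}"
    by (rule islimpt_subset[of x "{x..x + 1}"]) (use assms in \<open>auto simp: islimpt_Icc\<close>)
  then show ?thesis by (simp add: trivial_limit_within)
qed

lemma at_within_atMost_nontrivial:
  fixes a x :: real assumes "x \<le> a" shows "at x within {..a} \<noteq> bot"
proof -
  have "x islimpt {..a}"
    by (rule islimpt_subset[of x "{x - 1..x}"]) (use assms in \<open>auto simp: islimpt_Icc\<close>)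
  then show ?thesis by (simp add: trivial_limit_within)
qed

lemma has_vector_derivative_componentwise:
  fixes x :: "real \<Rightarrow> real ^ 'n"
  shows "(x has_vector_derivative y) (at s within S) \<longleftrightarrow>
    (\<forall>i. ((\<lambda>r. x r $ i) has_real_derivative y $ i) (at s within S))"
  unfolding has_real_derivative_iff_has_vector_derivative has_vector_derivative_def
  by (subst has_derivative_componentwise_within) (auto simp: Basis_vec_def inner_axis)

text \<open>The coordinate line through \<open>p\<close> stays in the domain \<open>D\<close> of differentiability, so the partial derivative is
the derivative in the direction of the axis; nontriviality of the filter makes it unique. With
\<open>S = {0..}\<close> and \<open>D\<close> the orthant this covers boundary points.\<close>

lemma partial_within_eq:
  assumes f: "(f has_derivative f') (at p within D)"
    and D: "\<And>x. x \<in> S \<Longrightarrow> set_coord p i x \<in> D" and S: "at (p $ i) within S \<noteq> bot"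
  shows "partial_within S f i p = f' (axis i 1)"
proof -
  have line: "set_coord p i x = p + (x - p $ i) *\<^sub>R axis i 1" for x
    by (auto simp: set_coord_def vec_eq_iff axis_def)
  have "(set_coord p i has_derivative (\<lambda>h. h *\<^sub>R axis i 1)) (at (p $ i) within S)"
    unfolding line[abs_def] by (auto intro!: derivative_eq_intros)
  moreover have "(f has_derivative f') (at (set_coord p i (p $ i)) within set_coord p i ` S)"
    using D by (auto simp: line intro!: has_derivative_subset[OF f])
  ultimately have "((\<lambda>x. f (set_coord p i x)) has_derivative (\<lambda>h. f' (h *\<^sub>R axis i 1))) (at (p $ i) within S)"
    by (rule has_derivative_in_compose)
  then have "((\<lambda>x. f (set_coord p i x)) has_vector_derivative f' (axis i 1)) (at (p $ i) within S)"
    by (simp add: has_vector_derivative_def linear_simps(5)[OF has_derivative_bounded_linear[OF f]])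
  then show ?thesis unfolding partial_within_def by (rule vector_derivative_within[OF S])
qed

lemma partial_p_eq:
  assumes "(f has_derivative f') (at p within nonneg_orthant)" "p \<in> nonneg_orthant"
  shows "partial_within {0..} f i p = f' (axis i 1)"
  using assms
  by (intro partial_within_eq) (auto simp: nonneg_orthant_def set_coord_def intro!: at_within_atLeast_nontrivial)

lemma partial_UNIV_eq:
  assumes "(f has_derivative f') (at p)"
  shows "partial_within UNIV f i p = f' (axis i 1)"
  using assms by (intro partial_within_eq) auto

lemma has_derivative_grad_p:
  fixes p :: "real ^ 'n"
  assumes "(f has_derivative f') (at p within nonneg_orthant)" "p \<in> nonneg_orthant"
  shows "f' = (\<lambda>h. grad_p f p \<bullet> h)"
proof
  fix h :: "real ^ 'n"
  have lin: "linear f'" using assms(1) has_derivative_linear by blast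
  have "h = (\<Sum>i\<in>UNIV. h $ i *\<^sub>R axis i 1)"
    using basis_expansion[of h] by (simp add: scalar_mult_eq_scaleR)
  then have "f' h = f' (\<Sum>i\<in>UNIV. h $ i *\<^sub>R axis i 1)" by (rule arg_cong)
  also have "\<dots> = (\<Sum>i\<in>UNIV. h $ i * f' (axis i 1))"
    by (simp add: linear_sum[OF lin] linear_scale[OF lin])
  finally show "f' h = grad_p f p \<bullet> h"
    by (simp add: grad_p_def inner_vec_def partial_p_eq[OF assms] mult.commute)
qed

section \<open>The Hamiltonian of a reversible network\<close>

locale reversible_network =
  fixes Q :: "real ^ 'n ^ 'n" and \<pi> :: "real ^ 'n"
    and \<theta> :: "real \<Rightarrow> real \<Rightarrow> real" and L :: "'n \<Rightarrow> 'n \<Rightarrow> real \<Rightarrow> real" and F :: "real ^ 'n \<Rightarrow> real"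
  assumes pi_pos: "\<And>i. 0 < \<pi> $ i"
    and rev: "reversible Q \<pi>"
    and act: "activation \<theta>"
    and lag: "edge_lagrangians (edges Q \<pi>) L"
    and F_C1: "C1_rel F prob_simplex nonneg_orthant"
begin

abbreviation "\<omega> \<equiv> weight Q \<pi>"
abbreviation "E \<equiv> edges Q \<pi>"
abbreviation "N \<equiv> nbrs Q \<pi>"
abbreviation "w \<equiv> wgrad Q \<pi>"
abbreviation "\<Theta> \<equiv> theta_edge \<pi> \<theta>"
abbreviation "H i j \<equiv> conjugate (L i j)"
abbreviation "m i j \<equiv> conj_argmax (L i j)"
abbreviation "\<H> \<equiv> hamiltonian Q \<pi> \<theta> L F"

lemma weight_sym: "\<omega> i j = \<omega> j i"
  using rev by (simp add: weight_def reversible_def)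

lemma edges_sym: "(i, j) \<in> E \<Longrightarrow> (j, i) \<in> E"
  using weight_sym[of i j] by (auto simp: edges_def)

lemma sum_edges: "(\<Sum>(i, j)\<in>E. X i j) = (\<Sum>i\<in>UNIV. \<Sum>j\<in>N i. X i j)"
proof -
  have "E = Sigma UNIV N" by (auto simp: nbrs_def)
  then show ?thesis by (simp add: sum.Sigma)
qed

lemma sum_edges_swap: "(\<Sum>(i, j)\<in>E. X i j) = (\<Sum>(i, j)\<in>E. X j i)"
  by (rule sum.reindex_bij_witness[of _ prod.swap prod.swap]) (auto intro: edges_sym)

text \<open>The discrete counterpart of integration by parts: swapping the two ends of every edge maps the terms with
\<open>k $ j\<close> to minus those with \<open>k $ i\<close>. The factor 1/2 compensates that both orientations of an edge
occur.\<close>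

lemma edge_sum_by_parts:
  fixes k :: "real ^ 'n"
  assumes "\<And>i j. (i, j) \<in> E \<Longrightarrow> Y j i = - Y i j"
  shows "1/2 * (\<Sum>(i, j)\<in>E. Y i j * (k $ j - k $ i)) = - (\<Sum>i\<in>UNIV. k $ i * (\<Sum>j\<in>N i. Y i j))"
proof -
  have "(\<Sum>(i, j)\<in>E. Y i j * k $ j) = (\<Sum>(i, j)\<in>E. Y j i * k $ i)"
    by (rule sum_edges_swap)
  also have "\<dots> = - (\<Sum>(i, j)\<in>E. Y i j * k $ i)"
    unfolding sum_negf[symmetric] by (rule sum.cong) (auto simp: assms)
  finally have "(\<Sum>(i, j)\<in>E. Y i j * (k $ j - k $ i)) = - 2 * (\<Sum>(i, j)\<in>E. Y i j * k $ i)"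
    by (simp add: right_diff_distrib sum_subtractf split_beta)
  moreover have "(\<Sum>(i, j)\<in>E. Y i j * k $ i) = (\<Sum>i\<in>UNIV. k $ i * (\<Sum>j\<in>N i. Y i j))"
    by (simp add: sum_edges sum_distrib_left mult.commute)
  ultimately show ?thesis by simp
qed

lemma lagrangian:
  assumes "(i, j) \<in> E"
  shows "strictly_convex (L i j)" "superlinear (L i j)" "L i j (- a) = L i j a" "L j i = L i j"
  using lag assms unfolding edge_lagrangians_def by fastforce+

lemma wgrad_antisym: "w \<Phi> j i = - w \<Phi> i j"
  using weight_sym[of i j] by (simp add: wgrad_def algebra_simps)

lemma velocity_antisym: "(i, j) \<in> E \<Longrightarrow> m j i (w \<Phi> j i) = - m i j (w \<Phi> i j)"
  using wgrad_antisym[of \<Phi> j i] conj_argmax_odd[of "L i j"] lagrangian[of i j] by simp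

lemma edge_energy_sym: "(i, j) \<in> E \<Longrightarrow> H j i (w \<Phi> j i) = H i j (w \<Phi> i j)"
  using wgrad_antisym[of \<Phi> j i] conjugate_even[of "L i j"] lagrangian[of i j] by simp

lemma theta_edge_sym: "p \<in> nonneg_orthant \<Longrightarrow> \<Theta> j i p = \<Theta> i j p"
  using act pi_pos by (simp add: activation_def theta_edge_def nonneg_orthant_def less_imp_le)

lemma theta_edge_nonneg: "p \<in> nonneg_orthant \<Longrightarrow> 0 \<le> \<Theta> i j p"
  using act pi_pos by (simp add: activation_def theta_edge_def nonneg_orthant_def less_imp_le)

text \<open>Both partial derivatives are expressed through the derivative of an edge in its first vertex, by
symmetry of \<open>\<theta>\<close>. This is the form in which the mean field game system contains them.\<close>

lemma theta_edge_has_derivative: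
  assumes p: "p \<in> nonneg_orthant" and "i \<noteq> j"
  shows "(\<Theta> i j has_derivative
    (\<lambda>h. h $ i * partial_within {0..} (\<Theta> i j) i p + h $ j * partial_within {0..} (\<Theta> j i) j p))
    (at p within nonneg_orthant)"
proof -
  have "C1_rel (\<lambda>(x, y). \<theta> x y) ({0..} \<times> {0..}) ({0..} \<times> {0..})"
    using act by (simp only: activation_def)
  then obtain g where g: "\<And>x. x \<in> {0..} \<times> {0..} \<Longrightarrow>
      ((\<lambda>(x, y). \<theta> x y) has_derivative (\<lambda>h. g x \<bullet> h)) (at x within {0..} \<times> {0..})"
    unfolding C1_rel_def by (elim exE conjE) (rule that, erule bspec)
  define \<gamma> where "\<gamma> = g (p $ i / \<pi> $ i, p $ j / \<pi> $ j)"
  let ?c = "\<lambda>q::real ^ 'n. (q $ i / \<pi> $ i, q $ j / \<pi> $ j)"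
  let ?D = "\<lambda>h. \<gamma> \<bullet> ?c h"
  have c_mem: "?c q \<in> {0..} \<times> {0..}" if "q \<in> nonneg_orthant" for q
    using that pi_pos by (auto simp: nonneg_orthant_def less_imp_le)
  have "(?c has_derivative ?c) (at p within nonneg_orthant)"
    by (rule has_derivative_Pair[OF bounded_linear.has_derivative[OF bounded_linear_divide]
          bounded_linear.has_derivative[OF bounded_linear_divide]])
       (rule bounded_linear.has_derivative[OF bounded_linear_vec_nth has_derivative_ident])+
  moreover have "((\<lambda>(x, y). \<theta> x y) has_derivative (\<lambda>h. \<gamma> \<bullet> h)) (at (?c p) within ?c ` nonneg_orthant)"
    unfolding \<gamma>_def by (rule has_derivative_subset[OF g[OF c_mem[OF p]]]) (auto dest: c_mem)
  ultimately have "((\<lambda>q. (\<lambda>(x, y). \<theta> x y) (?c q)) has_derivative ?D) (at p within nonneg_orthant)"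
    by (rule has_derivative_in_compose)
  then have D: "(\<Theta> i j has_derivative ?D) (at p within nonneg_orthant)"
    by (simp add: theta_edge_def[abs_def])
  then have D': "(\<Theta> j i has_derivative ?D) (at p within nonneg_orthant)"
    by (rule has_derivative_transform[OF p _, rotated]) (rule theta_edge_sym)
  have eq: "?D = (\<lambda>h. h $ i * ?D (axis i 1) + h $ j * ?D (axis j 1))"
    using \<open>i \<noteq> j\<close> by (cases \<gamma>) (simp add: axis_def fun_eq_iff mult.commute)
  show ?thesis
    unfolding partial_p_eq[OF D p] partial_p_eq[OF D' p] by (rule has_derivative_eq_rhs[OF D eq])
qed

lemma F_has_derivative:
  assumes "p \<in> prob_simplex"
  shows "(F has_derivative (\<lambda>h. grad_p F p \<bullet> h)) (at p within nonneg_orthant)"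
proof -
  obtain g where g: "(F has_derivative (\<lambda>h. g p \<bullet> h)) (at p within nonneg_orthant)"
    using F_C1 assms unfolding C1_rel_def by blast
  moreover have "(\<lambda>h. g p \<bullet> h) = (\<lambda>h. grad_p F p \<bullet> h)"
    using has_derivative_grad_p[OF g] assms prob_simplex_subset_orthant by blast
  ultimately show ?thesis by simp
qed

text \<open>\<open>velocity\<close> and \<open>force\<close> are the gradients of the Hamiltonian in \<open>\<Phi>\<close> and in \<open>p\<close>. In the mean field game
system \<open>p\<close> moves with the velocity and \<open>\<Phi>\<close> with minus the force.\<close>

definition velocity :: "real ^ 'n \<Rightarrow> real ^ 'n \<Rightarrow> real ^ 'n" where
  "velocity p \<Phi> = (\<chi> i. - (\<Sum>j\<in>N i. sqrt (\<omega> i j) * \<Theta> i j p * m i j (w \<Phi> i j)))"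

definition force :: "real ^ 'n \<Rightarrow> real ^ 'n \<Rightarrow> real ^ 'n" where
  "force p \<Phi> = (\<chi> i. (\<Sum>j\<in>N i. H i j (w \<Phi> i j) * partial_within {0..} (\<Theta> i j) i p)
                     + partial_within {0..} F i p)"

lemma flux_antisym:
  assumes "p \<in> nonneg_orthant" "(i, j) \<in> E" "v j i = - v i j"
  shows "sqrt (\<omega> j i) * \<Theta> j i p * v j i = - (sqrt (\<omega> i j) * \<Theta> i j p * v i j)"
  using assms theta_edge_sym[OF assms(1), of j i] weight_sym[of i j] by simp

lemma edge_term_has_derivative:
  assumes p: "p \<in> nonneg_orthant" and ij: "(i, j) \<in> E"
  shows "((\<lambda>z. H i j (w (snd z) i j) * \<Theta> i j (fst z)) has_derivative
    (\<lambda>z. H i j (w \<Phi> i j) * (fst z $ i * partial_within {0..} (\<Theta> i j) i p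
                              + fst z $ j * partial_within {0..} (\<Theta> j i) j p)
       + w (snd z) i j * m i j (w \<Phi> i j) * \<Theta> i j p)) (at (p, \<Phi>) within nonneg_orthant \<times> UNIV)"
proof -
  let ?F = "at (p, \<Phi>) within nonneg_orthant \<times> UNIV"
  let ?D = "\<lambda>h. h $ i * partial_within {0..} (\<Theta> i j) i p + h $ j * partial_within {0..} (\<Theta> j i) j p"
  have w: "((\<lambda>z. w (snd z) i j) has_derivative (\<lambda>z. w (snd z) i j)) ?F"
    unfolding wgrad_def
    by (intro has_derivative_mult_right has_derivative_diff has_derivative_snd has_derivative_ident
        bounded_linear.has_derivative[OF bounded_linear_vec_nth])
  have energy: "((\<lambda>z. H i j (w (snd z) i j)) has_derivative
      (\<lambda>z. w (snd z) i j * m i j (w \<Phi> i j))) ?F"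
    by (rule DERIV_compose_FDERIV[OF _ w]) (simp add: conjugate_DERIV lagrangian[OF ij])
  have "(fst has_derivative fst) ?F" by (auto intro!: derivative_eq_intros)
  moreover have "(\<Theta> i j has_derivative ?D) (at (fst (p, \<Phi>)) within fst ` (nonneg_orthant \<times> UNIV))"
    using theta_edge_has_derivative[OF p, of i j] ij by (simp add: edges_def)
  ultimately have "((\<lambda>z. \<Theta> i j (fst z)) has_derivative (\<lambda>z. ?D (fst z))) ?F"
    by (rule has_derivative_in_compose)
  from has_derivative_mult[OF energy this] show ?thesis by simp
qed

lemma flux_pairing:
  assumes "p \<in> nonneg_orthant" "\<And>i j. (i, j) \<in> E \<Longrightarrow> v j i = - v i j"
  shows "1/2 * (\<Sum>(i, j)\<in>E. w k i j * v i j * \<Theta> i j p)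
       = - (\<Sum>i\<in>UNIV. k $ i * (\<Sum>j\<in>N i. sqrt (\<omega> i j) * \<Theta> i j p * v i j))"
proof -
  have "(\<Sum>(i, j)\<in>E. w k i j * v i j * \<Theta> i j p)
      = (\<Sum>(i, j)\<in>E. sqrt (\<omega> i j) * \<Theta> i j p * v i j * (k $ j - k $ i))"
    by (rule sum.cong) (auto simp: wgrad_def)
  then show ?thesis
    using edge_sum_by_parts[of "\<lambda>i j. sqrt (\<omega> i j) * \<Theta> i j p * v i j" k]
      flux_antisym[OF assms(1)] assms(2) by simp
qed

text \<open>\<open>A i j\<close> stands for the derivative of the activation of the edge in the mass of its first vertex. Each
edge carries the same energy in both orientations, so the two summands contribute equally.\<close>

lemma energy_pairing:
  "1/2 * (\<Sum>(i, j)\<in>E. H i j (w \<Phi> i j) * (h $ i * A i j + h $ j * A j i))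
       = (\<Sum>i\<in>UNIV. h $ i * (\<Sum>j\<in>N i. H i j (w \<Phi> i j) * A i j))"
proof -
  have "(\<Sum>(i, j)\<in>E. H i j (w \<Phi> i j) * (h $ j * A j i))
      = (\<Sum>(i, j)\<in>E. H j i (w \<Phi> j i) * (h $ i * A i j))"
    by (rule sum_edges_swap)
  also have "\<dots> = (\<Sum>(i, j)\<in>E. H i j (w \<Phi> i j) * (h $ i * A i j))"
    by (rule sum.cong) (auto simp: edge_energy_sym)
  finally have "1/2 * (\<Sum>(i, j)\<in>E. H i j (w \<Phi> i j) * (h $ i * A i j + h $ j * A j i))
      = (\<Sum>(i, j)\<in>E. H i j (w \<Phi> i j) * (h $ i * A i j))"
    by (simp add: distrib_left sum.distrib split_beta)
  also have "\<dots> = (\<Sum>i\<in>UNIV. h $ i * (\<Sum>j\<in>N i. H i j (w \<Phi> i j) * A i j))"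
    by (simp add: sum_edges sum_distrib_left mult.left_commute)
  finally show ?thesis .
qed

text \<open>Joint differentiability, rather than the mere existence of partial derivatives, is needed for the
chain rule along curves in phase space.\<close>

lemma hamiltonian_has_derivative:
  assumes p: "p \<in> prob_simplex"
  shows "((\<lambda>z. \<H> (fst z) (snd z)) has_derivative
           (\<lambda>z. force p \<Phi> \<bullet> fst z + velocity p \<Phi> \<bullet> snd z))
         (at (p, \<Phi>) within nonneg_orthant \<times> UNIV)"
proof -
  let ?F = "at (p, \<Phi>) within nonneg_orthant \<times> UNIV"
  let ?A = "\<lambda>i j. partial_within {0..} (\<Theta> i j) i p"
  let ?f = "\<lambda>e z. H (fst e) (snd e) (w (snd z) (fst e) (snd e)) * \<Theta> (fst e) (snd e) (fst z)"
  let ?f' = "\<lambda>e z. H (fst e) (snd e) (w \<Phi> (fst e) (snd e)) *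
          (fst z $ fst e * ?A (fst e) (snd e) + fst z $ snd e * ?A (snd e) (fst e))
       + w (snd z) (fst e) (snd e) * m (fst e) (snd e) (w \<Phi> (fst e) (snd e)) * \<Theta> (fst e) (snd e) p"
  have p': "p \<in> nonneg_orthant" using p prob_simplex_subset_orthant by blast
  have "(fst has_derivative fst) ?F" by (auto intro!: derivative_eq_intros)
  moreover have "(F has_derivative (\<lambda>h. grad_p F p \<bullet> h)) (at (fst (p, \<Phi>)) within fst ` (nonneg_orthant \<times> UNIV))"
    using F_has_derivative[OF p] by simp
  ultimately have "((\<lambda>z. F (fst z)) has_derivative (\<lambda>z. grad_p F p \<bullet> fst z)) ?F"
    by (rule has_derivative_in_compose)
  moreover have "((\<lambda>z. \<Sum>e\<in>E. ?f e z) has_derivative (\<lambda>z. \<Sum>e\<in>E. ?f' e z)) ?F"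
    by (rule has_derivative_sum) (rule edge_term_has_derivative[OF p'], simp)
  ultimately have D: "((\<lambda>z. 1/2 * (\<Sum>e\<in>E. ?f e z) + F (fst z)) has_derivative
      (\<lambda>z. 1/2 * (\<Sum>e\<in>E. ?f' e z) + grad_p F p \<bullet> fst z)) ?F"
    by (intro has_derivative_add has_derivative_mult_right)
  have "1/2 * (\<Sum>e\<in>E. ?f' e z) + grad_p F p \<bullet> fst z = force p \<Phi> \<bullet> fst z + velocity p \<Phi> \<bullet> snd z" for z
  proof -
    obtain h k where z: "z = (h, k)" by (cases z)
    have "1/2 * (\<Sum>e\<in>E. ?f' e z) = 1/2 * (\<Sum>(i, j)\<in>E. H i j (w \<Phi> i j) * (h $ i * ?A i j + h $ j * ?A j i))
        + 1/2 * (\<Sum>(i, j)\<in>E. w k i j * m i j (w \<Phi> i j) * \<Theta> i j p)"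
      unfolding z split_beta sum.distrib fst_conv snd_conv by (rule distrib_left)
    also have "1/2 * (\<Sum>(i, j)\<in>E. w k i j * m i j (w \<Phi> i j) * \<Theta> i j p) = velocity p \<Phi> \<bullet> k"
      using flux_pairing[OF p', of "\<lambda>i j. m i j (w \<Phi> i j)" k] velocity_antisym
      by (simp add: velocity_def inner_vec_def sum_negf mult.commute)
    also have "1/2 * (\<Sum>(i, j)\<in>E. H i j (w \<Phi> i j) * (h $ i * ?A i j + h $ j * ?A j i))
        = force p \<Phi> \<bullet> h - grad_p F p \<bullet> h"
      unfolding energy_pairing
      by (simp add: force_def grad_p_def inner_vec_def sum_subtractf[symmetric] mult.commute distrib_left)
    finally show ?thesis by (simp add: z diff_divide_distrib add_divide_distrib)
  qed
  then show ?thesis using D by (simp add: hamiltonian_def[abs_def] split_beta)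
qed

lemma partial_hamiltonian_momentum:
  assumes "p \<in> prob_simplex"
  shows "partial_within UNIV (\<lambda>\<Psi>. \<H> p \<Psi>) i \<Phi> = velocity p \<Phi> $ i"
proof -
  have "p \<in> nonneg_orthant" using assms prob_simplex_subset_orthant by blast
  then have "((\<lambda>z. \<H> (fst z) (snd z)) has_derivative (\<lambda>z. force p \<Phi> \<bullet> fst z + velocity p \<Phi> \<bullet> snd z))
      (at (p, \<Phi>) within range (Pair p))"
    by (intro has_derivative_subset[OF hamiltonian_has_derivative[OF assms]]) auto
  moreover have "(Pair p has_derivative (\<lambda>k. (0, k))) (at \<Phi>)"
    by (rule has_derivative_Pair[OF has_derivative_const has_derivative_ident])
  ultimately have "((\<lambda>\<Psi>. \<H> p \<Psi>) has_derivative (\<lambda>k. velocity p \<Phi> \<bullet> k)) (at \<Phi>)"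
    using has_derivative_in_compose[of "Pair p" "\<lambda>k. (0, k)" \<Phi> UNIV "\<lambda>z. \<H> (fst z) (snd z)"
      "\<lambda>z. force p \<Phi> \<bullet> fst z + velocity p \<Phi> \<bullet> snd z"] by simp
  then show ?thesis by (simp add: partial_UNIV_eq inner_axis)
qed

lemma partial_hamiltonian_position:
  assumes "p \<in> prob_simplex"
  shows "partial_within {0..} (\<lambda>q. \<H> q \<Phi>) i p = force p \<Phi> $ i"
proof -
  have p: "p \<in> nonneg_orthant" using assms prob_simplex_subset_orthant by blast
  have "((\<lambda>z. \<H> (fst z) (snd z)) has_derivative (\<lambda>z. force p \<Phi> \<bullet> fst z + velocity p \<Phi> \<bullet> snd z))
      (at (p, \<Phi>) within (\<lambda>q. (q, \<Phi>)) ` nonneg_orthant)"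
    by (intro has_derivative_subset[OF hamiltonian_has_derivative[OF assms]]) auto
  moreover have "((\<lambda>q. (q, \<Phi>)) has_derivative (\<lambda>h. (h, 0))) (at p within nonneg_orthant)"
    by (rule has_derivative_Pair[OF has_derivative_ident has_derivative_const])
  ultimately have "((\<lambda>q. \<H> q \<Phi>) has_derivative (\<lambda>h. force p \<Phi> \<bullet> h)) (at p within nonneg_orthant)"
    using has_derivative_in_compose[of "\<lambda>q. (q, \<Phi>)" "\<lambda>h. (h, 0)" p nonneg_orthant "\<lambda>z. \<H> (fst z) (snd z)"
      "\<lambda>z. force p \<Phi> \<bullet> fst z + velocity p \<Phi> \<bullet> snd z"]
    by simp
  then show ?thesis using p by (simp add: partial_p_eq inner_axis)
qed

section \<open>Hamilton's equations\<close>

lemma hamiltonian_system_iff: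
  "hamiltonian_system \<H> G t T p0 p \<Phi> \<longleftrightarrow>
     (\<forall>s\<in>{t..T}. p s \<in> prob_simplex) \<and>
     (\<forall>s\<in>{t..T}. (p has_vector_derivative velocity (p s) (\<Phi> s)) (at s within {t..T})) \<and>
     (\<forall>s\<in>{t..T}. (\<Phi> has_vector_derivative - force (p s) (\<Phi> s)) (at s within {t..T})) \<and>
     p t = p0 \<and> \<Phi> T = grad_p G (p T)"
  unfolding hamiltonian_system_def has_vector_derivative_componentwise
  by (auto simp: partial_hamiltonian_momentum partial_hamiltonian_position vec_eq_iff grad_p_def)

lemma mfg_iff_hamiltonian_system:
  "mfg_system Q \<pi> \<theta> L F G t T p0 p \<Phi> \<longleftrightarrow> hamiltonian_system \<H> G t T p0 p \<Phi>"
proof -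
  have "deriv (H i j) b = m i j b" if "j \<in> N i" for i j b
    using conjugate_DERIV[OF lagrangian(1,2)] that by (intro DERIV_imp_deriv) (simp add: nbrs_def)
  then show ?thesis
    unfolding mfg_system_def hamiltonian_system_def
    by (auto simp: partial_hamiltonian_momentum partial_hamiltonian_position velocity_def force_def)
qed

end

section \<open>Conservation of energy and bi-characteristics\<close>

text \<open>The two functions have the same vector derivatives, hence also the same default value where there
is none.\<close>

lemma partial_within_add_const: "partial_within S (\<lambda>x. c + f x) i p = partial_within S f i p"
proof -
  have "((\<lambda>x. c + g x) has_vector_derivative d) F \<longleftrightarrow> (g has_vector_derivative d) F" for g :: "real \<Rightarrow> real" and d F
    by (simp add: has_vector_derivative_def has_derivative_def)
  then show ?thesis by (simp add: partial_within_def vector_derivative_def)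
qed

context reversible_network begin

text \<open>The chain rule gives \<open>force \<bullet> velocity - velocity \<bullet> force\<close>.\<close>

lemma hamiltonian_conserved:
  assumes sys: "hamiltonian_system \<H> G t T p0 p \<Phi>" and s: "s \<in> {t..T}"
  shows "((\<lambda>r. \<H> (p r) (\<Phi> r)) has_real_derivative 0) (at s within {t..T})"
proof -
  have p: "\<And>r. r \<in> {t..T} \<Longrightarrow> p r \<in> prob_simplex"
    and dp: "(p has_vector_derivative velocity (p s) (\<Phi> s)) (at s within {t..T})"
    and d\<Phi>: "(\<Phi> has_vector_derivative - force (p s) (\<Phi> s)) (at s within {t..T})"
    using sys s unfolding hamiltonian_system_iff by auto
  have "(\<lambda>r. (p r, \<Phi> r)) ` {t..T} \<subseteq> nonneg_orthant \<times> UNIV"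
    using p prob_simplex_subset_orthant by auto
  note dH = has_derivative_subset[OF hamiltonian_has_derivative[OF p[OF s], of "\<Phi> s"] this]
  note dc = has_derivative_Pair[OF dp[unfolded has_vector_derivative_def] d\<Phi>[unfolded has_vector_derivative_def]]
  show ?thesis
    using has_derivative_in_compose[OF dc dH]
    by (simp add: has_real_derivative_iff_has_vector_derivative has_vector_derivative_def inner_commute)
qed

text \<open>The symbol is \<open>\<tau> + H\<close>: it does not depend on time, so \<open>\<tau>\<close> is constant along a bi-characteristic, and
vanishing of the symbol forces \<open>\<tau> = - H\<close>. Energy conservation is precisely what makes this choice of
\<open>\<tau>\<close> admissible.\<close>

lemma hamiltonian_iff_bicharacteristic_system:
  "hamiltonian_system \<H> G t T p0 p \<Phi> \<longleftrightarrow> hj_bicharacteristic_system \<H> G t T p0 p \<Phi>"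
proof -
  have d1: "deriv (\<lambda>\<tau>'. hj_symbol \<H> x r q \<tau>') \<tau> = 1" for x r q \<tau>
    unfolding hj_symbol_def by (rule DERIV_imp_deriv) (auto intro!: derivative_eq_intros)
  have d2: "deriv (\<lambda>r. hj_symbol \<H> x r q \<tau>) s = 0" for x q s \<tau>
    by (simp add: hj_symbol_def)
  have bichar: "bicharacteristic (hj_symbol \<H>) {t..T} p (\<lambda>s. s) \<Phi> \<tau> \<longleftrightarrow>
     (\<forall>s\<in>{t..T}. \<tau> s + \<H> (p s) (\<Phi> s) = 0 \<and>
        (\<forall>i. ((\<lambda>r. p r $ i) has_real_derivative partial_within UNIV (\<lambda>\<Psi>. \<H> (p s) \<Psi>) i (\<Phi> s))
          (at s within {t..T})) \<and>
        (\<forall>i. ((\<lambda>r. \<Phi> r $ i) has_real_derivative - partial_within {0..} (\<lambda>q. \<H> q (\<Phi> s)) i (p s))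
          (at s within {t..T})) \<and>
        (\<tau> has_real_derivative 0) (at s within {t..T}))" for \<tau>
    unfolding bicharacteristic_def d1 d2 by (simp add: hj_symbol_def partial_within_add_const)
  show ?thesis
  proof
    assume sys: "hamiltonian_system \<H> G t T p0 p \<Phi>"
    have "((\<lambda>r. - \<H> (p r) (\<Phi> r)) has_real_derivative 0) (at s within {t..T})" if "s \<in> {t..T}" for s
      using DERIV_minus[OF hamiltonian_conserved[OF sys that]] by simp
    then have "bicharacteristic (hj_symbol \<H>) {t..T} p (\<lambda>s. s) \<Phi> (\<lambda>s. - \<H> (p s) (\<Phi> s))"
      using sys unfolding bichar hamiltonian_system_def by simp
    then show "hj_bicharacteristic_system \<H> G t T p0 p \<Phi>"
      using sys unfolding hj_bicharacteristic_system_def hamiltonian_system_def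
      by (auto simp: vec_eq_iff grad_p_def)
  next
    assume "hj_bicharacteristic_system \<H> G t T p0 p \<Phi>"
    then show "hamiltonian_system \<H> G t T p0 p \<Phi>"
      unfolding hj_bicharacteristic_system_def hamiltonian_system_def bichar
      by (auto simp: grad_p_def)
  qed
qed

end

section \<open>Verification of the value function and the optimal feedback\<close>

text \<open>The equation speaks of partial derivatives, the chain rule needs the full derivative. Restriction of
the latter to coordinate lines identifies its components with the partial derivatives, and the
equation then gives the time component.\<close>

lemma hj_gradient:
  fixes U :: "real ^ 'n \<Rightarrow> real \<Rightarrow> real"
  assumes "hj_classical_solution H G T U"
  shows "continuous_on (prob_simplex \<times> {..T}) (\<lambda>z. grad_p (\<lambda>q. U q (snd z)) (fst z))"
    and "\<And>p s. p \<in> prob_simplex \<Longrightarrow> s \<le> T \<Longrightarrow> ((\<lambda>(p, s). U p s) has_derivative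
      (\<lambda>h. grad_p (\<lambda>q. U q s) p \<bullet> fst h - H p (grad_p (\<lambda>q. U q s) p) * snd h))
      (at (p, s) within nonneg_orthant \<times> {..T})"
proof -
  have "C1_rel (\<lambda>(p, s). U p s) (prob_simplex \<times> {..T}) (nonneg_orthant \<times> {..T})"
    using assms by (simp only: hj_classical_solution_def)
  then obtain g where g: "continuous_on (prob_simplex \<times> {..T}) g"
    and dU: "\<And>z. z \<in> prob_simplex \<times> {..T} \<Longrightarrow>
      ((\<lambda>(p, s). U p s) has_derivative (\<lambda>h. g z \<bullet> h)) (at z within nonneg_orthant \<times> {..T})"
    unfolding C1_rel_def by (elim exE conjE) (rule that, assumption, erule bspec)
  have fst_g: "fst (g (p, s)) = grad_p (\<lambda>q. U q s) p" if p: "p \<in> prob_simplex" and s: "s \<le> T" for p s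
  proof -
    have p': "p \<in> nonneg_orthant" using p prob_simplex_subset_orthant by blast
    have "((\<lambda>(p, s). U p s) has_derivative (\<lambda>h. g (p, s) \<bullet> h)) (at (p, s) within (\<lambda>q. (q, s)) ` nonneg_orthant)"
      by (rule has_derivative_subset[OF dU]) (use p s in auto)
    from has_derivative_in_compose[OF has_derivative_Pair[OF has_derivative_ident has_derivative_const] this]
    have "((\<lambda>q. U q s) has_derivative (\<lambda>h. fst (g (p, s)) \<bullet> h)) (at p within nonneg_orthant)"
      by (simp add: inner_prod_def)
    then show ?thesis
      using partial_p_eq[OF _ p'] by (auto simp: vec_eq_iff grad_p_def inner_axis)
  qed
  have snd_g: "snd (g (p, s)) = - H p (grad_p (\<lambda>q. U q s) p)" if p: "p \<in> prob_simplex" and s: "s \<le> T" for p s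
  proof -
    have "((\<lambda>(p, s). U p s) has_derivative (\<lambda>h. g (p, s) \<bullet> h)) (at (p, s) within Pair p ` {..T})"
      by (rule has_derivative_subset[OF dU]) (use p s prob_simplex_subset_orthant in auto)
    from has_derivative_in_compose[OF has_derivative_Pair[OF has_derivative_const has_derivative_ident] this]
    have "((\<lambda>r. U p r) has_vector_derivative snd (g (p, s))) (at s within {..T})"
      by (simp add: inner_prod_def has_vector_derivative_def mult.commute)
    then have "vector_derivative (\<lambda>r. U p r) (at s within {..T}) = snd (g (p, s))"
      by (rule vector_derivative_within[OF at_within_atMost_nontrivial[OF s]])
    moreover have "vector_derivative (\<lambda>r. U p r) (at s within {..T}) + H p (grad_p (\<lambda>q. U q s) p) = 0"
      using assms p s unfolding hj_classical_solution_def by blast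
    ultimately show ?thesis by simp
  qed
  show "continuous_on (prob_simplex \<times> {..T}) (\<lambda>z. grad_p (\<lambda>q. U q (snd z)) (fst z))"
    by (rule continuous_on_eq[OF continuous_on_fst[OF g]]) (auto simp: fst_g)
  show "((\<lambda>(p, s). U p s) has_derivative
      (\<lambda>h. grad_p (\<lambda>q. U q s) p \<bullet> fst h - H p (grad_p (\<lambda>q. U q s) p) * snd h))
      (at (p, s) within nonneg_orthant \<times> {..T})" if "p \<in> prob_simplex" "s \<le> T" for p s
    by (rule has_derivative_eq_rhs[OF dU]) (auto simp: that inner_prod_def fst_g snd_g)
qed

lemma hj_derivative_along_curve:
  fixes U :: "real ^ 'n \<Rightarrow> real \<Rightarrow> real"
  assumes hj: "hj_classical_solution H G T U"
    and p: "\<And>r. r \<in> {t..T} \<Longrightarrow> p r \<in> prob_simplex" and s: "s \<in> {t..T}"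
    and dp: "(p has_vector_derivative u) (at s within {t..T})"
  shows "((\<lambda>r. U (p r) r) has_vector_derivative
    grad_p (\<lambda>q. U q s) (p s) \<bullet> u - H (p s) (grad_p (\<lambda>q. U q s) (p s))) (at s within {t..T})"
proof -
  have "s \<le> T" using s by simp
  have "(\<lambda>r. (p r, r)) ` {t..T} \<subseteq> nonneg_orthant \<times> {..T}"
    using p prob_simplex_subset_orthant by auto
  note dU = has_derivative_subset[OF hj_gradient(2)[OF hj p[OF s] \<open>s \<le> T\<close>] this]
  note dc = has_derivative_Pair[OF dp[unfolded has_vector_derivative_def] has_derivative_ident]
  show ?thesis
    using has_derivative_in_compose[OF dc dU]
    by (simp add: has_vector_derivative_def algebra_simps)
qed

context reversible_network begin

lemma pairing_as_edge_sum:
  assumes "p \<in> nonneg_orthant" "\<And>i j. (i, j) \<in> E \<Longrightarrow> v j i = - v i j"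
    and "\<And>i. u $ i + (\<Sum>j\<in>N i. sqrt (\<omega> i j) * \<Theta> i j p * v i j) = 0"
  shows "\<Phi> \<bullet> u = 1/2 * (\<Sum>(i, j)\<in>E. w \<Phi> i j * v i j * \<Theta> i j p)"
proof -
  have "u $ i = - (\<Sum>j\<in>N i. sqrt (\<omega> i j) * \<Theta> i j p * v i j)" for i
    using assms(3)[of i] by linarith
  then have "\<Phi> \<bullet> u = - (\<Sum>i\<in>UNIV. \<Phi> $ i * (\<Sum>j\<in>N i. sqrt (\<omega> i j) * \<Theta> i j p * v i j))"
    by (simp add: inner_vec_def sum_negf)
  also have "\<dots> = 1/2 * (\<Sum>(i, j)\<in>E. w \<Phi> i j * v i j * \<Theta> i j p)"
    by (rule flux_pairing[OF assms(1), symmetric]) (rule assms(2))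
  finally show ?thesis .
qed

lemma cost_plus_hamiltonian:
  "running_cost Q \<pi> \<theta> L F p v + \<H> p \<Phi>
     = 1/2 * (\<Sum>(i, j)\<in>E. (L i j (v i j) + H i j (w \<Phi> i j)) * \<Theta> i j p)"
  by (simp add: running_cost_def hamiltonian_def split_beta distrib_right distrib_left sum.distrib mult.commute)

text \<open>The Fenchel--Young inequality on every edge, weighted with \<open>\<theta>\<close>.\<close>

lemma pairing_le_cost_plus_hamiltonian:
  assumes "p \<in> nonneg_orthant" "\<And>i j. (i, j) \<in> E \<Longrightarrow> v j i = - v i j"
    and "\<And>i. u $ i + (\<Sum>j\<in>N i. sqrt (\<omega> i j) * \<Theta> i j p * v i j) = 0"
  shows "\<Phi> \<bullet> u \<le> running_cost Q \<pi> \<theta> L F p v + \<H> p \<Phi>"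
proof -
  have "w \<Phi> i j * v i j * \<Theta> i j p \<le> (L i j (v i j) + H i j (w \<Phi> i j)) * \<Theta> i j p" if "(i, j) \<in> E" for i j
    using Fenchel_Young[OF lagrangian(1,2)[OF that], of "v i j" "w \<Phi> i j"] theta_edge_nonneg[OF assms(1)]
    by (intro mult_right_mono) (auto simp: mult.commute)
  then have "(\<Sum>(i, j)\<in>E. w \<Phi> i j * v i j * \<Theta> i j p)
      \<le> (\<Sum>(i, j)\<in>E. (L i j (v i j) + H i j (w \<Phi> i j)) * \<Theta> i j p)"
    by (intro sum_mono) auto
  moreover have "\<Phi> \<bullet> u = 1/2 * (\<Sum>(i, j)\<in>E. w \<Phi> i j * v i j * \<Theta> i j p)"
    by (rule pairing_as_edge_sum[OF assms(1)]) (fact assms(2,3))+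
  ultimately show ?thesis unfolding cost_plus_hamiltonian by simp
qed

lemma velocity_continuity_equation:
  "velocity p \<Phi> $ i + (\<Sum>j\<in>N i. sqrt (\<omega> i j) * \<Theta> i j p * m i j (w \<Phi> i j)) = 0"
  by (simp add: velocity_def)

text \<open>The case of equality in the Fenchel--Young inequality.\<close>

lemma feedback_attains_hamiltonian:
  assumes "p \<in> nonneg_orthant"
  shows "\<Phi> \<bullet> velocity p \<Phi> = running_cost Q \<pi> \<theta> L F p (\<lambda>i j. m i j (w \<Phi> i j)) + \<H> p \<Phi>"
proof -
  have "(\<Sum>(i, j)\<in>E. w \<Phi> i j * m i j (w \<Phi> i j) * \<Theta> i j p)
      = (\<Sum>(i, j)\<in>E. (L i j (m i j (w \<Phi> i j)) + H i j (w \<Phi> i j)) * \<Theta> i j p)"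
    by (rule sum.cong) (auto simp: conjugate_eq_argmax lagrangian mult.commute)
  then show ?thesis
    unfolding cost_plus_hamiltonian
    by (simp add: pairing_as_edge_sum[OF assms velocity_antisym velocity_continuity_equation])
qed

text \<open>The difference of the running cost and the derivative of \<open>U (p s) s\<close> is the nonnegative gap in
\<open>pairing_le_cost_plus_hamiltonian\<close> at \<open>\<Phi> = \<nabla>U\<close>.\<close>

lemma payoff_le:
  assumes hj: "hj_classical_solution \<H> G T U" and "t \<le> T"
    and adm: "(p, v) \<in> admissible Q \<pi> \<theta> L F t T p0"
  shows "G (p T) - integral {t..T} (\<lambda>s. running_cost Q \<pi> \<theta> L F (p s) (v s)) \<le> U p0 t"
proof -
  let ?c = "\<lambda>s. running_cost Q \<pi> \<theta> L F (p s) (v s)"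
  have p: "\<And>s. s \<in> {t..T} \<Longrightarrow> p s \<in> prob_simplex" and p_init: "p t = p0"
    and v: "\<And>s i j. s \<in> {t..T} \<Longrightarrow> (i, j) \<in> E \<Longrightarrow> v s j i = - v s i j"
    and int: "?c integrable_on {t..T}"
    using adm edges_sym unfolding admissible_def by fastforce+
  obtain u where dp: "\<And>s. s \<in> {t..T} \<Longrightarrow> (p has_vector_derivative u s) (at s within {t..T})"
    and u: "\<And>s i. s \<in> {t..T} \<Longrightarrow>
      u s $ i + (\<Sum>j\<in>N i. sqrt (\<omega> i j) * \<Theta> i j (p s) * v s i j) = 0"
    using adm unfolding admissible_def by blast
  let ?d = "\<lambda>s. grad_p (\<lambda>q. U q s) (p s) \<bullet> u s - \<H> (p s) (grad_p (\<lambda>q. U q s) (p s))"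
  have "(?d has_integral (U (p T) T - U (p t) t)) {t..T}"
    by (rule fundamental_theorem_of_calculus[OF \<open>t \<le> T\<close>])
       (rule hj_derivative_along_curve[OF hj p _ dp])
  moreover have "(?c has_integral integral {t..T} ?c) {t..T}" using int by (rule integrable_integral)
  moreover have "?d s \<le> ?c s" if s: "s \<in> {t..T}" for s
    using pairing_le_cost_plus_hamiltonian[OF _ v[OF s] u[OF s], of "grad_p (\<lambda>q. U q s) (p s)"]
      p[OF s] prob_simplex_subset_orthant by force
  ultimately have "U (p T) T - U (p t) t \<le> integral {t..T} ?c" by (rule has_integral_le)
  moreover have "U (p T) T = G (p T)"
    using hj p[of T] \<open>t \<le> T\<close> unfolding hj_classical_solution_def by simp
  ultimately show ?thesis by (simp add: p_init)
qed

text \<open>\<open>\<theta> 0 y = 0\<close>, and \<open>\<theta>\<close> is Lipschitz on the compact box of the values taken by the densities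
\<open>p $ i / \<pi> $ i\<close> on the simplex.\<close>

lemma theta_edge_le_mass: "\<exists>C\<ge>0. \<forall>p\<in>prob_simplex. \<Theta> i j p \<le> C * p $ i"
proof -
  have "C1_rel (\<lambda>(x, y). \<theta> x y) ({0..} \<times> {0..}) ({0..} \<times> {0..})"
    using act by (simp only: activation_def)
  then obtain g where cont: "continuous_on ({0..} \<times> {0..}) g" and g: "\<And>x. x \<in> {0..} \<times> {0..} \<Longrightarrow>
      ((\<lambda>(x, y). \<theta> x y) has_derivative (\<lambda>h. g x \<bullet> h)) (at x within {0..} \<times> {0..})"
    unfolding C1_rel_def by (elim exE conjE) (rule that, assumption, erule bspec)
  let ?B = "{0..1 / \<pi> $ i} \<times> {0..1 / \<pi> $ j}"
  have B: "?B \<subseteq> {0..} \<times> {0..}" by auto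
  have "bounded (g ` ?B)"
    by (intro compact_imp_bounded compact_continuous_image continuous_on_subset[OF cont B] compact_Times) auto
  then obtain C where C: "0 < C" "\<And>z. z \<in> ?B \<Longrightarrow> norm (g z) \<le> C"
    unfolding bounded_pos by blast
  have "\<Theta> i j p \<le> C / \<pi> $ i * p $ i" if p: "p \<in> prob_simplex" for p
  proof -
    define x where "x = p $ i / \<pi> $ i"
    define y where "y = p $ j / \<pi> $ j"
    have nonneg: "0 \<le> p $ k" for k using p by (simp add: prob_simplex_def)
    have xy: "(x, y) \<in> ?B" "(0, y) \<in> ?B"
      using nonneg prob_simplex_nth_le[OF p] pi_pos
      by (auto simp: x_def y_def divide_right_mono less_imp_le)
    have "norm ((\<lambda>(x, y). \<theta> x y) (x, y) - (\<lambda>(x, y). \<theta> x y) (0, y)) \<le> C * norm ((x, y) - (0, y))"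
    proof (rule differentiable_bound[of ?B _ "\<lambda>z h. g z \<bullet> h"])
      show "convex ?B" by (intro convex_Times) auto
      fix z assume z: "z \<in> ?B"
      show "((\<lambda>(x, y). \<theta> x y) has_derivative (\<lambda>h. g z \<bullet> h)) (at z within ?B)"
        using B z by (intro has_derivative_subset[OF g]) auto
      show "onorm (\<lambda>h. g z \<bullet> h) \<le> C"
      proof (rule onorm_bound)
        fix h
        have "norm (g z \<bullet> h) \<le> norm (g z) * norm h" by (simp add: Cauchy_Schwarz_ineq2)
        also have "\<dots> \<le> C * norm h" using C(2)[OF z] by (intro mult_right_mono) auto
        finally show "norm (g z \<bullet> h) \<le> C * norm h" .
      qed (use C in simp)
    qed (use xy in auto)
    moreover have "\<theta> 0 y = 0"
    proof -
      have "\<forall>x\<ge>0. \<forall>y\<ge>0. x * y = 0 \<longrightarrow> \<theta> x y = 0"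
        using act unfolding activation_def by (elim conjE)
      then show ?thesis using xy by auto
    qed
    ultimately have "\<bar>\<theta> x y\<bar> \<le> C * \<bar>x\<bar>" by simp
    then show ?thesis
      using nonneg[of i] pi_pos[of i] by (simp add: theta_edge_def x_def y_def)
  qed
  then show ?thesis using C(1) pi_pos[of i] by (intro exI[of _ "C / \<pi> $ i"]) auto
qed

text \<open>Conservation of mass: the velocity is orthogonal to the constants, whose discrete gradient
vanishes.\<close>

lemma velocity_sum_zero:
  assumes "p \<in> nonneg_orthant"
  shows "(\<Sum>i\<in>UNIV. velocity p \<Phi> $ i) = 0"
proof -
  have "(\<chi> i. 1) \<bullet> velocity p \<Phi> = 0"
    using pairing_as_edge_sum[OF assms velocity_antisym velocity_continuity_equation, of "\<chi> i. 1" \<Phi>]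
    by (simp add: wgrad_def)
  then show ?thesis by (simp add: inner_vec_def)
qed

lemma feedback_continuous:
  assumes "j \<in> N i" "continuous_on S k"
  shows "continuous_on S (\<lambda>z. m i j (w (k z) i j))"
proof -
  have ij: "(i, j) \<in> E" using assms(1) by (simp add: nbrs_def)
  have "continuous_on UNIV (m i j)"
    using conj_argmax_isCont[OF lagrangian(1,2)[OF ij]] by (simp add: continuous_at_imp_continuous_on)
  then show ?thesis
    by (rule continuous_on_compose2) (auto simp: wgrad_def intro!: continuous_intros assms(2))
qed

lemma theta_edge_continuous:
  assumes "j \<in> N i"
  shows "continuous_on nonneg_orthant (\<Theta> i j)"
proof -
  have "i \<noteq> j" using assms by (auto simp: nbrs_def edges_def)
  then show ?thesis
    unfolding continuous_on_eq_continuous_within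
    using theta_edge_has_derivative has_derivative_continuous by blast
qed

lemma velocity_continuous:
  assumes "continuous_on S x" "continuous_on S k" "\<And>z. z \<in> S \<Longrightarrow> x z \<in> nonneg_orthant"
  shows "continuous_on S (\<lambda>z. velocity (x z) (k z))"
  unfolding velocity_def
proof (intro continuous_on_vec_lambda continuous_on_minus continuous_on_sum continuous_on_mult continuous_on_const)
  fix i j assume j: "j \<in> N i"
  show "continuous_on S (\<lambda>z. \<Theta> i j (x z))"
    by (rule continuous_on_compose2[OF theta_edge_continuous[OF j] assms(1)]) (use assms(3) in auto)
  show "continuous_on S (\<lambda>z. m i j (w (k z) i j))"
    by (rule feedback_continuous[OF j assms(2)])
qed

text \<open>The quantitative tangency of the velocity to the faces of the simplex: on a compact set the feedback is
bounded, and the activation of an edge is at most a multiple of the mass at either end.\<close>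

lemma velocity_lower_bound:
  assumes "compact S" "continuous_on S k" "\<And>z. z \<in> S \<Longrightarrow> x z \<in> prob_simplex"
  shows "\<exists>C\<ge>0. \<forall>z\<in>S. \<forall>i. - C * x z $ i \<le> velocity (x z) (k z) $ i"
proof -
  define P where "P i j C \<longleftrightarrow> (j \<in> N i \<longrightarrow>
    (\<forall>z\<in>S. sqrt (\<omega> i j) * \<Theta> i j (x z) * m i j (w (k z) i j) \<le> C * x z $ i))" for i j C
  have "\<exists>C\<ge>0. P i j C" for i j
  proof (cases "j \<in> N i")
    case True
    obtain A where A: "A \<ge> 0" "\<And>p. p \<in> prob_simplex \<Longrightarrow> \<Theta> i j p \<le> A * p $ i"
      using theta_edge_le_mass by blast
    have "bounded ((\<lambda>z. m i j (w (k z) i j)) ` S)"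
      by (intro compact_imp_bounded compact_continuous_image feedback_continuous[OF True] assms)
    then obtain B where B: "0 < B" "\<And>z. z \<in> S \<Longrightarrow> \<bar>m i j (w (k z) i j)\<bar> \<le> B"
      unfolding bounded_pos by auto
    have \<omega>: "0 \<le> sqrt (\<omega> i j)" using True by (auto simp: nbrs_def edges_def)
    have "sqrt (\<omega> i j) * \<Theta> i j (x z) * m i j (w (k z) i j) \<le> (sqrt (\<omega> i j) * A * B) * x z $ i"
      if z: "z \<in> S" for z
    proof -
      have \<Theta>: "0 \<le> \<Theta> i j (x z)"
        using theta_edge_nonneg assms(3)[OF z] prob_simplex_subset_orthant by blast
      have "\<Theta> i j (x z) * m i j (w (k z) i j) \<le> \<Theta> i j (x z) * B"
        using \<Theta> B(2)[OF z] by (intro mult_left_mono) auto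
      also have "\<dots> \<le> A * x z $ i * B" using A(2)[OF assms(3)[OF z]] B(1) by (intro mult_right_mono) auto
      finally show ?thesis using mult_left_mono[OF _ \<omega>] by (fastforce simp: algebra_simps)
    qed
    then show ?thesis using A(1) B(1) \<omega> unfolding P_def
      by (intro exI[of _ "sqrt (\<omega> i j) * A * B"]) auto
  qed (auto simp: P_def)
  then obtain C where C0: "\<And>i j. 0 \<le> C i j" "\<And>i j. P i j (C i j)"
    by metis
  have C: "sqrt (\<omega> i j) * \<Theta> i j (x z) * m i j (w (k z) i j) \<le> C i j * x z $ i"
    if "j \<in> N i" "z \<in> S" for i j z
    using C0(2)[of i j] that by (simp add: P_def)
  define D where "D = (\<Sum>i\<in>UNIV. \<Sum>j\<in>N i. C i j)"
  have "- D * x z $ i \<le> velocity (x z) (k z) $ i" if z: "z \<in> S" for z i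
  proof -
    have "(\<Sum>j\<in>N i. sqrt (\<omega> i j) * \<Theta> i j (x z) * m i j (w (k z) i j)) \<le> (\<Sum>j\<in>N i. C i j) * x z $ i"
      unfolding sum_distrib_right by (intro sum_mono C z)
    also have "\<dots> \<le> D * x z $ i"
    proof (rule mult_right_mono)
      show "(\<Sum>j\<in>N i. C i j) \<le> D"
        unfolding D_def by (rule member_le_sum) (auto intro!: sum_nonneg C0(1))
      show "0 \<le> x z $ i" using assms(3)[OF z] by (simp add: prob_simplex_def)
    qed
    finally show ?thesis by (simp add: velocity_def)
  qed
  moreover have "0 \<le> D" unfolding D_def by (intro sum_nonneg C0(1))
  ultimately show ?thesis by blast
qed

text \<open>\<open>K\<close> is the spatial gradient of \<open>U\<close> and \<open>f\<close> the closed-loop field of the feedback control. The optimal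
curve solves \<open>p' = f s p\<close>, and the derivative of \<open>U (p s) s\<close> equals the running cost, which is
therefore integrable with the required integral.\<close>

lemma optimal_pair_exists:
  assumes hj: "hj_classical_solution \<H> G T U" and "t \<le> T" and p0: "p0 \<in> prob_simplex"
  obtains p v where "(p, v) \<in> admissible Q \<pi> \<theta> L F t T p0"
    "G (p T) - integral {t..T} (\<lambda>s. running_cost Q \<pi> \<theta> L F (p s) (v s)) = U p0 t"
proof -
  define K where "K s q = grad_p (\<lambda>q. U q s) q" for s q
  define f where "f s q = velocity q (K s q)" for s q
  let ?S = "{t..T} \<times> (prob_simplex :: (real ^ 'n) set)"
  have orthant: "q \<in> nonneg_orthant" if "q \<in> prob_simplex" for q :: "real ^ 'n"
    using that prob_simplex_subset_orthant by blast
  have swap: "prod.swap ` ?S \<subseteq> prob_simplex \<times> {..T}" by auto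
  have contK: "continuous_on ?S (\<lambda>z. K (fst z) (snd z))"
    using continuous_on_compose2[OF hj_gradient(1)[OF hj] continuous_on_swap swap]
    by (simp add: K_def)
  then have "continuous_on ?S (\<lambda>z. f (fst z) (snd z))"
    unfolding f_def by (intro velocity_continuous) (auto intro!: continuous_intros orthant)
  then have contf: "continuous_on ?S (\<lambda>(s, q). f s q)" by (simp add: split_beta)
  have "compact ?S" by (intro compact_Times compact_prob_simplex) auto
  then obtain C where C: "C \<ge> 0" "\<And>z i. z \<in> ?S \<Longrightarrow> - C * snd z $ i \<le> velocity (snd z) (K (fst z) (snd z)) $ i"
    using velocity_lower_bound[OF _ contK, of snd] by auto
  obtain p where p_init: "p t = p0" and p: "\<And>s. s \<in> {t..T} \<Longrightarrow> p s \<in> prob_simplex"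
    and dp: "\<And>s. s \<in> {t..T} \<Longrightarrow> (p has_vector_derivative f s (p s)) (at s within {t..T})"
  \<comment> \<open>With \<open>C\<close> from \<open>velocity_lower_bound\<close>, a step of length \<open>h\<close> leaves at least \<open>(1 - h * C) * q $ i\<close>
    at vertex \<open>i\<close>.\<close>
  proof (rule Peano_in_invariant_set[OF \<open>t \<le> T\<close> compact_prob_simplex p0 contf, of "1 / (C + 1)"])
    show "0 < 1 / (C + 1)" using C(1) by simp
    fix s h and q :: "real ^ 'n"
    assume s: "s \<in> {t..T}" and q: "q \<in> prob_simplex" and h: "0 \<le> h" "h \<le> 1 / (C + 1)"
    have "0 \<le> (q + h *\<^sub>R f s q) $ i" for i
    proof -
      have qi: "0 \<le> q $ i" using q by (simp add: prob_simplex_def)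
      have "h * C \<le> 1" using h C(1) by (simp add: pos_le_divide_eq algebra_simps)
      then have "h * C * q $ i \<le> 1 * q $ i" using qi by (rule mult_right_mono)
      moreover have "h * (- C * q $ i) \<le> h * f s q $ i"
        using C(2)[of "(s, q)" i] s q h(1) by (intro mult_left_mono) (auto simp: f_def)
      ultimately show ?thesis by simp
    qed
    moreover have "(\<Sum>i\<in>UNIV. (q + h *\<^sub>R f s q) $ i) = 1"
      using q velocity_sum_zero[OF orthant[OF q]]
      by (simp add: f_def sum.distrib sum_distrib_left[symmetric] prob_simplex_def)
    ultimately show "q + h *\<^sub>R f s q \<in> prob_simplex" by (simp add: prob_simplex_def)
  qed blast
  define v where "v s i j = m i j (w (K s (p s)) i j)" for s i j
  let ?c = "\<lambda>s. running_cost Q \<pi> \<theta> L F (p s) (v s)"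
  have c_eq: "K s (p s) \<bullet> f s (p s) - \<H> (p s) (K s (p s)) = ?c s" if "s \<in> {t..T}" for s
    using feedback_attains_hamiltonian[OF orthant[OF p[OF that]], of "K s (p s)"]
    by (simp add: f_def v_def[abs_def])
  have int: "(?c has_integral (U (p T) T - U (p t) t)) {t..T}"
  proof (rule fundamental_theorem_of_calculus[OF \<open>t \<le> T\<close>])
    fix s assume s: "s \<in> {t..T}"
    show "((\<lambda>r. U (p r) r) has_vector_derivative ?c s) (at s within {t..T})"
      using hj_derivative_along_curve[OF hj p s dp[OF s]] c_eq[OF s] by (simp add: K_def)
  qed
  have contp: "continuous_on {t..T} p"
    unfolding continuous_on_eq_continuous_within using dp has_vector_derivative_continuous by blast
  have graph: "(\<lambda>s. (s, p s)) ` {t..T} \<subseteq> ?S" using p by auto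
  have cont_u: "continuous_on {t..T} (\<lambda>s. f s (p s))"
    using continuous_on_compose2[OF contf continuous_on_Pair[OF continuous_on_id contp] graph] by simp
  have continuity: "f s (p s) $ i + (\<Sum>j\<in>N i. sqrt (\<omega> i j) * \<Theta> i j (p s) * v s i j) = 0" for s i
    unfolding f_def v_def by (rule velocity_continuity_equation)
  have antisym: "v s i j = - v s j i" if "(i, j) \<in> E" for s i j
    using velocity_antisym[OF that, of "K s (p s)"] by (simp add: v_def)
  have adm: "(p, v) \<in> admissible Q \<pi> \<theta> L F t T p0"
    unfolding admissible_def mem_Collect_eq split_conv
    by (intro conjI ballI allI exI[of _ "\<lambda>s. f s (p s)"] p cont_u dp continuity p_init
        has_integral_integrable[OF int]) (auto intro: antisym)
  have "U (p T) T = G (p T)"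
    using hj p[of T] \<open>t \<le> T\<close> unfolding hj_classical_solution_def by simp
  then have "G (p T) - integral {t..T} ?c = U p0 t"
    unfolding integral_unique[OF int] p_init by simp
  with adm show ?thesis by (rule that)
qed

lemma value_function_eq:
  assumes "hj_classical_solution \<H> G T U" "t \<le> T" "p0 \<in> prob_simplex"
  shows "value_function Q \<pi> \<theta> L F G T p0 t = ereal (U p0 t)"
  unfolding value_function_def
proof (rule antisym)
  show "(SUP (p, v)\<in>admissible Q \<pi> \<theta> L F t T p0.
      ereal (G (p T) - integral {t..T} (\<lambda>s. running_cost Q \<pi> \<theta> L F (p s) (v s)))) \<le> ereal (U p0 t)"
  proof (rule SUP_least, clarify)
    fix p v assume "(p, v) \<in> admissible Q \<pi> \<theta> L F t T p0"
    from payoff_le[OF assms(1,2) this]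
    show "ereal (G (p T) - integral {t..T} (\<lambda>s. running_cost Q \<pi> \<theta> L F (p s) (v s))) \<le> ereal (U p0 t)"
      by simp
  qed
  obtain p v where "(p, v) \<in> admissible Q \<pi> \<theta> L F t T p0"
    "G (p T) - integral {t..T} (\<lambda>s. running_cost Q \<pi> \<theta> L F (p s) (v s)) = U p0 t"
    using optimal_pair_exists[OF assms] by blast
  then show "ereal (U p0 t) \<le> (SUP (p, v)\<in>admissible Q \<pi> \<theta> L F t T p0.
      ereal (G (p T) - integral {t..T} (\<lambda>s. running_cost Q \<pi> \<theta> L F (p s) (v s))))"
    by (intro SUP_upper2[of "(p, v)"]) (simp_all only: split_conv)
qed

end

theorem proposition3p15:
  fixes Q :: "real ^ 'n ^ 'n" and \<pi> :: "real ^ 'n"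
    and \<theta> :: "real \<Rightarrow> real \<Rightarrow> real"
    and L :: "'n \<Rightarrow> 'n \<Rightarrow> real \<Rightarrow> real"
    and F G :: "real ^ 'n \<Rightarrow> real"
    and T :: real
  assumes "generator Q"
    and "invariant_measure Q \<pi>"
    and "\<And>i. 0 < \<pi> $ i"
    and "\<And>\<mu>. invariant_measure Q \<mu> \<Longrightarrow> \<mu> = \<pi>"
    and "reversible Q \<pi>"
    and "activation \<theta>"
    and "edge_lagrangians (edges Q \<pi>) L"
    and "C1_rel F prob_simplex nonneg_orthant"
    and "C1_rel G prob_simplex nonneg_orthant"
  shows "(\<forall>t\<le>T. \<forall>p0\<in>prob_simplex. \<forall>p \<Phi>.
            mfg_system Q \<pi> \<theta> L F G t T p0 p \<Phi> \<longleftrightarrow>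
            hamiltonian_system (hamiltonian Q \<pi> \<theta> L F) G t T p0 p \<Phi>)
       \<and> (\<forall>U. hj_classical_solution (hamiltonian Q \<pi> \<theta> L F) G T U \<longrightarrow>
            (\<forall>t\<le>T. \<forall>p0\<in>prob_simplex.
               value_function Q \<pi> \<theta> L F G T p0 t = ereal (U p0 t) \<and>
               (\<forall>p \<Phi>. hamiltonian_system (hamiltonian Q \<pi> \<theta> L F) G t T p0 p \<Phi> \<longleftrightarrow>
                  hj_bicharacteristic_system (hamiltonian Q \<pi> \<theta> L F) G t T p0 p \<Phi>)))"
proof -
  interpret reversible_network Q \<pi> \<theta> L F
    by unfold_locales (fact assms)+
  show ?thesis
    by (simp add: mfg_iff_hamiltonian_system hamiltonian_iff_bicharacteristic_system value_function_eq)
qed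

end
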